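(* If $f\in\mathcal{A}_n^*+\mathcal{A}_n$, then $u:=P[f]$ is a free pluriharmonic function on the open operatorial unit $n$-ball such that (i) $u$ has a continuous extension $\tilde u$ to $[B(\mathcal{H})^n]_1^-$ for any Hilbert space $\mathcal{H}$, in the operator norm; (ii) $\tilde u(S_1,\ldots,S_n)=f$.
   Context: $\mathbb{F}_n^+$ is the unital free semigroup on generators $g_1,\ldots,g_n$ with identity $g_0$; $|\alpha|$ is word length; $X_\alpha:=X_{i_1}\cdots X_{i_k}$ if $\alpha=g_{i_1}\cdots g_{i_k}$, $X_{g_0}:=I$. $[B(\mathcal{H})^n]_1$ and $[B(\mathcal{H})^n]_1^-$ are the sets of $[X_1,\ldots,X_n]\in B(\mathcal{H})^n$ with $\|\sum_iX_iX_i^*\|<1$, respectively $\le1$. $F^2(H_n)=\mathbb{C}1\oplus\bigoplus_{m\ge1}H_n^{\otimes m}$ is the full Fock space, $H_n$ an $n$-dimensional Hilbert space with orthonormal basis $e_1,\ldots,e_n$; $e_\alpha:=e_{i_1}\otimes\cdots\otimes e_{i_k}$, $e_{g_0}:=1$; $S_i\xi:=e_i\otimes\xi$ are the left creation operators. $\mathcal{A}_n\subset B(F^2(H_n))$ is the norm closed algebra generated by $S_1,\ldots,S_n$ and the identity; $\mathcal{A}_n^*+\mathcal{A}_n:=\{h^*+g:h,g\in\mathcal{A}_n\}$. Noncommutative Poisson transform: for a Hilbert space $\mathcal{H}$ and $X=[X_1,\ldots,X_n]\in[B(\mathcal{H})^n]_1$ let $\Delta_X:=(I-\sum_iX_iX_i^*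 )^{1/2}$ and $K_X:\mathcal{H}\to F^2(H_n)\otimes\mathcal{H}$, $K_Xh:=\sum_{\alpha\in\mathbb{F}_n^+}e_\alpha\otimes\Delta_XX_\alpha^*h$. For $A\in B(F^2(H_n))$, $P[A](X):=K_X^*(A\otimes I_{\mathcal{H}})K_X$. A free holomorphic function on the open operatorial unit $n$-ball is given by $F(X)=\sum_{k=0}^\infty\sum_{|\alpha|=k}a_\alpha X_\alpha$, $X\in[B(\mathcal{H})^n]_1$, for every Hilbert space $\mathcal{H}$, where $a_\alpha\in\mathbb{C}$, $\limsup_{k\to\infty}(\sum_{|\alpha|=k}|a_\alpha|^2)^{1/2k}\le1$. A free pluriharmonic function is one of the form $\mathrm{Re}\,F_1+i\,\mathrm{Re}\,F_2$ with $F_1,F_2$ free holomorphic, $\mathrm{Re}\,F(X):=\frac12(F(X)+F(X)^* )$. In (ii), $\tilde u$ is the extension for $\mathcal{H}=F^2(H_n)$. *)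

theory Defs
  imports "HOL-Analysis.Analysis"
begin

section \<open>Complex Hilbert spaces\<close>

class complex_vector = real_vector +
  fixes scaleC :: "complex \<Rightarrow> 'a \<Rightarrow> 'a"  (infixr "*\<^sub>C" 75)
  assumes scaleC_add_right: "c *\<^sub>C (x + y) = c *\<^sub>C x + c *\<^sub>C y"
    and scaleC_add_left: "(c + d) *\<^sub>C x = c *\<^sub>C x + d *\<^sub>C x"
    and scaleC_scaleC: "c *\<^sub>C d *\<^sub>C x = (c * d) *\<^sub>C x"
    and scaleC_of_real: "complex_of_real r *\<^sub>C x = r *\<^sub>R x"

text \<open>The inner product is linear in the first argument and conjugate linear in the second.
  Completeness comes from \<^class>\<open>banach\<close>; the space may be finite-dimensional or non-separable.\<close>

class complex_hilbert = complex_vector + banach +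
  fixes cinner :: "'a \<Rightarrow> 'a \<Rightarrow> complex"
  assumes cinner_commute: "cinner x y = cnj (cinner y x)"
    and cinner_add_left: "cinner (x + y) z = cinner x z + cinner y z"
    and cinner_scaleC_left: "cinner (c *\<^sub>C x) y = c * cinner x y"
    and cinner_self: "cinner x x = complex_of_real ((norm x)\<^sup>2)"

lemma scaleC_one [simp]: "1 *\<^sub>C (x::'a::complex_vector) = x"
  using scaleC_of_real[of 1 x] by simp

lemma cinner_zero_left [simp]: "cinner 0 (y::'a::complex_hilbert) = 0"
  using cinner_add_left[of 0 0 y] by simp

lemma cinner_minus_left: "cinner (- x) (y::'a::complex_hilbert) = - cinner x y"
  using cinner_add_left[of x "- x" y] by (simp add: minus_unique)

lemma cinner_diff_left: "cinner (x - z) (y::'a::complex_hilbert) = cinner x y - cinner z y"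
  using cinner_add_left[of x "- z" y] by (simp add: cinner_minus_left)

lemma cinner_diff_right: "cinner y (x - z::'a::complex_hilbert) = cinner y x - cinner y z"
  by (metis cinner_commute cinner_diff_left complex_cnj_diff)

lemma cinner_scaleC_right: "cinner x (c *\<^sub>C y::'a::complex_hilbert) = cnj c * cinner x y"
  by (metis cinner_commute cinner_scaleC_left complex_cnj_mult)

lemma norm_scaleC: "norm (c *\<^sub>C x::'a::complex_hilbert) = cmod c * norm x"
proof -
  have "complex_of_real ((norm (c *\<^sub>C x))\<^sup>2) = c * cnj c * complex_of_real ((norm x)\<^sup>2)"
    unfolding cinner_self[symmetric] by (simp add: cinner_scaleC_left cinner_scaleC_right)
  also have "\<dots> = complex_of_real ((cmod c * norm x)\<^sup>2)"
    by (simp add: complex_norm_square[symmetric] power_mult_distrib)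
  finally have "complex_of_real ((norm (c *\<^sub>C x))\<^sup>2) = complex_of_real ((cmod c * norm x)\<^sup>2)" .
  then have "(norm (c *\<^sub>C x))\<^sup>2 = (cmod c * norm x)\<^sup>2"
    using of_real_eq_iff by blast
  then show ?thesis by simp
qed

lemma cinner_Cauchy_Schwarz: "cmod (cinner x (y::'a::complex_hilbert)) \<le> norm x * norm y"
proof (cases "y = 0")
  case True
  then show ?thesis
    by (metis cinner_commute cinner_zero_left complex_cnj_zero mult_zero_right norm_zero order_refl)
next
  case False
  define c where "c = cinner x y"
  define r where "r = (norm y)\<^sup>2"
  have r: "r > 0" using False by (simp add: r_def)
  define d where "d = c / complex_of_real r"
  have yy: "cinner y y = of_real r" by (simp add: cinner_self r_def)
  have yx: "cinner y x = cnj c" by (simp add: c_def cinner_commute[of y x])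
  have "complex_of_real ((norm (x - d *\<^sub>C y))\<^sup>2)
      = of_real ((norm x)\<^sup>2) - cnj d * c - d * cnj c + d * cnj d * of_real r"
    unfolding cinner_self[symmetric]
    by (simp add: cinner_diff_left cinner_diff_right cinner_scaleC_left cinner_scaleC_right
        yy yx c_def[symmetric] algebra_simps)
  also have "\<dots> = of_real ((norm x)\<^sup>2) - (c * cnj c) / of_real r"
    using r by (simp add: d_def field_simps)
  also have "\<dots> = complex_of_real ((norm x)\<^sup>2 - (cmod c)\<^sup>2 / r)"
    by (simp add: complex_norm_square[symmetric])
  finally have "(norm (x - d *\<^sub>C y))\<^sup>2 = (norm x)\<^sup>2 - (cmod c)\<^sup>2 / r"
    using of_real_eq_iff by blast
  then have "(cmod c)\<^sup>2 / r \<le> (norm x)\<^sup>2"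
    by (metis diff_ge_0_iff_ge zero_le_power2)
  then have "(cmod c)\<^sup>2 \<le> (norm x * norm y)\<^sup>2"
    using r by (simp add: r_def power_mult_distrib field_simps)
  then show ?thesis
    unfolding c_def by (rule power2_le_imp_le) simp
qed

instantiation complex :: complex_hilbert
begin

definition scaleC_complex :: "complex \<Rightarrow> complex \<Rightarrow> complex" where
  "scaleC_complex c x = c * x"

definition cinner_complex :: "complex \<Rightarrow> complex \<Rightarrow> complex" where
  "cinner_complex x y = x * cnj y"

instance
  by standard
    (simp_all add: scaleC_complex_def cinner_complex_def algebra_simps scaleR_conv_of_real
      complex_norm_square[symmetric])

end


section \<open>Hilbert sums\<close>

text \<open>\<open>('i, 'a) ell2\<close> is the Hilbert sum of copies of the Hilbert space \<open>'a\<close> indexed by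
  the type \<open>'i\<close>. It is the usual model of the Hilbert tensor product of
  \<open>('i, complex) ell2\<close> with \<open>'a\<close>; see \<open>tensor_vec\<close> below.\<close>

typedef (overloaded) ('i, 'a::complex_hilbert) ell2 =
  "{v :: 'i \<Rightarrow> 'a. (\<lambda>i. (norm (v i))\<^sup>2) summable_on UNIV}"
  morphisms coord Abs_ell2
proof
  show "(\<lambda>_. 0) \<in> {v :: 'i \<Rightarrow> 'a. (\<lambda>i. (norm (v i))\<^sup>2) summable_on UNIV}" by simp
qed

setup_lifting type_definition_ell2

lemma square_summable_add:
  fixes v w :: "'i \<Rightarrow> 'a::real_normed_vector"
  assumes "(\<lambda>i. (norm (v i))\<^sup>2) summable_on UNIV" "(\<lambda>i. (norm (w i))\<^sup>2) summable_on UNIV"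
  shows "(\<lambda>i. (norm (v i + w i))\<^sup>2) summable_on UNIV"
proof (rule summable_on_comparison_test)
  show "(\<lambda>i. 2 * (norm (v i))\<^sup>2 + 2 * (norm (w i))\<^sup>2) summable_on UNIV"
    by (intro summable_on_add summable_on_cmult_right assms)
  fix i
  have "(norm (v i + w i))\<^sup>2 \<le> (norm (v i) + norm (w i))\<^sup>2"
    by (simp add: norm_triangle_ineq power_mono)
  also have "\<dots> \<le> 2 * (norm (v i))\<^sup>2 + 2 * (norm (w i))\<^sup>2"
    using sum_squares_bound[of "norm (v i)" "norm (w i)"] by (simp add: power2_sum)
  finally show "(norm (v i + w i))\<^sup>2 \<le> 2 * (norm (v i))\<^sup>2 + 2 * (norm (w i))\<^sup>2" .
qed simp

instantiation ell2 :: (type, complex_hilbert) complex_vector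
begin

lift_definition zero_ell2 :: "('a, 'b) ell2" is "\<lambda>_. 0" by simp

lift_definition plus_ell2 :: "('a, 'b) ell2 \<Rightarrow> ('a, 'b) ell2 \<Rightarrow> ('a, 'b) ell2"
  is "\<lambda>v w i. v i + w i" by (simp add: square_summable_add)

lift_definition uminus_ell2 :: "('a, 'b) ell2 \<Rightarrow> ('a, 'b) ell2"
  is "\<lambda>v i. - v i" by simp

lift_definition minus_ell2 :: "('a, 'b) ell2 \<Rightarrow> ('a, 'b) ell2 \<Rightarrow> ('a, 'b) ell2"
  is "\<lambda>v w i. v i - w i"
  subgoal for v w using square_summable_add[of v "\<lambda>i. - w i"] by simp
  done

lift_definition scaleC_ell2 :: "complex \<Rightarrow> ('a, 'b) ell2 \<Rightarrow> ('a, 'b) ell2"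
  is "\<lambda>c v i. c *\<^sub>C v i"
  by (simp add: norm_scaleC power_mult_distrib summable_on_cmult_right)

lift_definition scaleR_ell2 :: "real \<Rightarrow> ('a, 'b) ell2 \<Rightarrow> ('a, 'b) ell2"
  is "\<lambda>r v i. r *\<^sub>R v i"
  by (simp add: power_mult_distrib summable_on_cmult_right)

instance
  by standard
    (transfer; auto simp: algebra_simps scaleC_add_right scaleC_add_left scaleC_scaleC scaleC_of_real)+

end

lemma coord_square_summable: "(\<lambda>i. (norm (coord v i))\<^sup>2) summable_on UNIV"
  using coord[of v] by simp

instantiation ell2 :: (type, complex_hilbert) real_normed_vector
begin

definition norm_ell2 :: "('a, 'b) ell2 \<Rightarrow> real" where
  "norm_ell2 v = sqrt (\<Sum>\<^sub>\<infinity>i. (norm (coord v i))\<^sup>2)"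

definition dist_ell2 :: "('a, 'b) ell2 \<Rightarrow> ('a, 'b) ell2 \<Rightarrow> real" where
  "dist_ell2 v w = norm (v - w)"

definition sgn_ell2 :: "('a, 'b) ell2 \<Rightarrow> ('a, 'b) ell2" where
  "sgn_ell2 v = inverse (norm v) *\<^sub>R v"

definition uniformity_ell2 :: "(('a, 'b) ell2 \<times> ('a, 'b) ell2) filter" where
  "uniformity_ell2 = (INF e\<in>{0<..}. principal {(x, y). dist x y < e})"

definition open_ell2 :: "('a, 'b) ell2 set \<Rightarrow> bool" where
  "open_ell2 U = (\<forall>x\<in>U. \<forall>\<^sub>F (x', y) in uniformity. x' = x \<longrightarrow> y \<in> U)"

lemma norm_ell2_square: "(norm (v::('a, 'b) ell2))\<^sup>2 = (\<Sum>\<^sub>\<infinity>i. (norm (coord v i))\<^sup>2)"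
  unfolding norm_ell2_def by (simp add: infsum_nonneg)

lemma L2_set_coord_le: "finite F \<Longrightarrow> L2_set (\<lambda>i. norm (coord (v::('a, 'b) ell2) i)) F \<le> norm v"
  unfolding norm_ell2_def L2_set_def
  by (intro real_sqrt_le_mono finite_sum_le_infsum coord_square_summable) auto

lemma norm_ell2_leI:
  assumes "\<And>F. finite F \<Longrightarrow> L2_set (\<lambda>i. norm (coord (v::('a, 'b) ell2) i)) F \<le> b"
  shows "norm v \<le> b"
proof -
  have b: "0 \<le> b" using assms[of "{}"] by simp
  have "(\<Sum>\<^sub>\<infinity>i. (norm (coord v i))\<^sup>2) \<le> b\<^sup>2"
  proof (rule infsum_le_finite_sums[OF coord_square_summable])
    fix F :: "'a set" assume "finite F"
    from assms[OF this] show "(\<Sum>i\<in>F. (norm (coord v i))\<^sup>2) \<le> b\<^sup>2"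
      unfolding L2_set_def by (rule sqrt_le_D)
  qed
  then show ?thesis unfolding norm_ell2_def using b by (simp add: real_le_lsqrt infsum_nonneg)
qed

instance
proof
  fix v w :: "('a, 'b) ell2" and r :: real
  show "dist v w = norm (v - w)" by (rule dist_ell2_def)
  show "sgn v = v /\<^sub>R norm v" by (rule sgn_ell2_def)
  show "uniformity = (INF e\<in>{0<..}. principal {(x, y::('a, 'b) ell2). dist x y < e})"
    by (rule uniformity_ell2_def)
  show "open U = (\<forall>x\<in>U. \<forall>\<^sub>F (x', y) in uniformity. x' = x \<longrightarrow> y \<in> U)"
    for U :: "('a, 'b) ell2 set" by (rule open_ell2_def)
  show "(norm v = 0) = (v = 0)"
  proof
    assume z: "norm v = 0"
    have "norm (coord v i) \<le> 0" for i using L2_set_coord_le[of "{i}" v] z by simp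
    then show "v = 0" by (intro coord_inject[THEN iffD1]) (auto simp: zero_ell2.rep_eq)
  qed (simp add: norm_ell2_def zero_ell2.rep_eq)
  show "norm (v + w) \<le> norm v + norm w"
  proof (rule norm_ell2_leI)
    fix F :: "'a set" assume F: "finite F"
    have "L2_set (\<lambda>i. norm (coord (v + w) i)) F
        \<le> L2_set (\<lambda>i. norm (coord v i) + norm (coord w i)) F"
      by (intro L2_set_mono) (auto simp: plus_ell2.rep_eq norm_triangle_ineq)
    also have "\<dots> \<le> L2_set (\<lambda>i. norm (coord v i)) F + L2_set (\<lambda>i. norm (coord w i)) F"
      by (rule L2_set_triangle_ineq)
    also have "\<dots> \<le> norm v + norm w" using F by (intro add_mono L2_set_coord_le)
    finally show "L2_set (\<lambda>i. norm (coord (v + w) i)) F \<le> norm v + norm w" .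
  qed
  show "norm (r *\<^sub>R v) = \<bar>r\<bar> * norm v"
    by (simp add: norm_ell2_def scaleR_ell2.rep_eq power_mult_distrib infsum_cmult_right'
        real_sqrt_mult)
qed

end

lemma norm_coord_le: "norm (coord v i) \<le> norm v"
  using L2_set_coord_le[of "{i}" v] by simp

instantiation ell2 :: (type, complex_hilbert) complex_hilbert
begin

definition cinner_ell2 :: "('a, 'b) ell2 \<Rightarrow> ('a, 'b) ell2 \<Rightarrow> complex" where
  "cinner_ell2 v w = (\<Sum>\<^sub>\<infinity>i. cinner (coord v i) (coord w i))"

lemma coord_cinner_summable: "(\<lambda>i. cinner (coord (v::('a, 'b) ell2) i) (coord w i)) summable_on UNIV"
proof (rule Infinite_Sum.abs_summable_summable, rule Infinite_Sum.abs_summable_on_comparison_test')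
  show "(\<lambda>i. (norm (coord v i))\<^sup>2 + (norm (coord w i))\<^sup>2) summable_on UNIV"
    by (intro summable_on_add coord_square_summable)
  fix i
  have "cmod (cinner (coord v i) (coord w i)) \<le> norm (coord v i) * norm (coord w i)"
    by (rule cinner_Cauchy_Schwarz)
  also have "\<dots> \<le> (norm (coord v i))\<^sup>2 + (norm (coord w i))\<^sup>2"
    using sum_squares_bound[of "norm (coord v i)" "norm (coord w i)"]
      mult_nonneg_nonneg[OF norm_ge_zero[of "coord v i"] norm_ge_zero[of "coord w i"]] by linarith
  finally show "norm (cinner (coord v i) (coord w i)) \<le> (norm (coord v i))\<^sup>2 + (norm (coord w i))\<^sup>2" .
qed

instance
proof
  fix X :: "nat \<Rightarrow> ('a, 'b) ell2"
  assume X: "Cauchy X"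
  have diff: "coord (v - w) i = coord v i - coord w i" for v w :: "('a, 'b) ell2" and i
    by (simp add: minus_ell2.rep_eq)
  have "Cauchy (\<lambda>k. coord (X k) i)" for i
  proof (rule CauchyI)
    fix e :: real assume "0 < e"
    from CauchyD[OF X this] obtain M where "\<forall>m\<ge>M. \<forall>k\<ge>M. norm (X m - X k) < e" by blast
    then show "\<exists>M. \<forall>m\<ge>M. \<forall>k\<ge>M. norm (coord (X m) i - coord (X k) i) < e"
      by (metis diff norm_coord_le order_le_less_trans)
  qed
  then have "\<exists>l. (\<lambda>k. coord (X k) i) \<longlonglongrightarrow> l" for i
    using Cauchy_convergent convergent_def by blast
  then obtain l where l: "\<And>i. (\<lambda>k. coord (X k) i) \<longlonglongrightarrow> l i" by metis
  have bound: "\<exists>M. \<forall>m\<ge>M. \<forall>F. finite F \<longrightarrow> L2_set (\<lambda>i. norm (coord (X m) i - l i)) F \<le> e"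
    if "0 < e" for e
  proof -
    from CauchyD[OF X that] obtain M where M: "\<forall>m\<ge>M. \<forall>k\<ge>M. norm (X m - X k) < e" by blast
    have "L2_set (\<lambda>i. norm (coord (X m) i - l i)) F \<le> e" if "m \<ge> M" "finite F" for m F
    proof (rule LIMSEQ_le_const2)
      show "(\<lambda>k. L2_set (\<lambda>i. norm (coord (X m) i - coord (X k) i)) F)
          \<longlonglongrightarrow> L2_set (\<lambda>i. norm (coord (X m) i - l i)) F"
        unfolding L2_set_def by (intro tendsto_intros l)
      have "L2_set (\<lambda>i. norm (coord (X m) i - coord (X k) i)) F \<le> e" if "k \<ge> M" for k
        using L2_set_coord_le[OF \<open>finite F\<close>, of "X m - X k"] M \<open>m \<ge> M\<close> that
        by (fastforce simp: diff)
      then show "\<exists>N. \<forall>k\<ge>N. L2_set (\<lambda>i. norm (coord (X m) i - coord (X k) i)) F \<le> e" by blast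
    qed
    then show ?thesis by blast
  qed
  from bound[of 1] obtain M where
    M: "\<And>F. finite F \<Longrightarrow> L2_set (\<lambda>i. norm (coord (X M) i - l i)) F \<le> 1" by auto
  have "(\<lambda>i. (norm (coord (X M) i - l i))\<^sup>2) summable_on UNIV"
  proof (rule nonneg_bdd_above_summable_on)
    show "bdd_above (sum (\<lambda>i. (norm (coord (X M) i - l i))\<^sup>2) ` {F. F \<subseteq> UNIV \<and> finite F})"
    proof (rule bdd_aboveI2)
      fix F assume "F \<in> {F. F \<subseteq> (UNIV::'a set) \<and> finite F}"
      then show "(\<Sum>i\<in>F. (norm (coord (X M) i - l i))\<^sup>2) \<le> 1\<^sup>2"
        using M[of F] unfolding L2_set_def by (intro sqrt_le_D) auto
    qed
  qed simp
  then have "(\<lambda>i. (norm (- (coord (X M) i - l i)))\<^sup>2) summable_on UNIV"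
    by (simp only: norm_minus_cancel)
  from square_summable_add[OF coord_square_summable[of "X M"] this]
  have "(\<lambda>i. (norm (l i))\<^sup>2) summable_on UNIV" by simp
  then have cL: "coord (Abs_ell2 l) = l" by (simp add: Abs_ell2_inverse)
  have "X \<longlonglongrightarrow> Abs_ell2 l"
  proof (rule LIMSEQ_I)
    fix e :: real assume "0 < e"
    then have "0 < e / 2" by simp
    from bound[OF this] obtain M where
      M: "\<forall>m\<ge>M. \<forall>F. finite F \<longrightarrow> L2_set (\<lambda>i. norm (coord (X m) i - l i)) F \<le> e / 2" by blast
    have "norm (X m - Abs_ell2 l) \<le> e / 2" if "m \<ge> M" for m
      using M that by (intro norm_ell2_leI) (simp add: diff cL)
    then show "\<exists>M. \<forall>m\<ge>M. norm (X m - Abs_ell2 l) < e" using \<open>0 < e\<close> by force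
  qed
  then show "convergent X" by (auto simp: convergent_def)
next
  fix x y z :: "('a, 'b) ell2" and c :: complex
  show "cinner x y = cnj (cinner y x)"
    unfolding cinner_ell2_def infsum_cnj[symmetric]
    by (rule infsum_cong) (rule cinner_commute)
  show "cinner (x + y) z = cinner x z + cinner y z"
    unfolding cinner_ell2_def
    by (simp add: plus_ell2.rep_eq cinner_add_left infsum_add coord_cinner_summable)
  show "cinner (c *\<^sub>C x) y = c * cinner x y"
    unfolding cinner_ell2_def
    by (simp add: scaleC_ell2.rep_eq cinner_scaleC_left infsum_cmult_right')
  have "((\<lambda>i. complex_of_real ((norm (coord x i))\<^sup>2)) has_sum complex_of_real ((norm x)\<^sup>2)) UNIV"
    unfolding norm_ell2_square
    by (intro has_sum_of_real has_sum_infsum coord_square_summable)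
  then show "cinner x x = complex_of_real ((norm x)\<^sup>2)"
    unfolding cinner_ell2_def cinner_self by (rule infsumI)
qed

end

lift_definition tensor_vec :: "('i, complex) ell2 \<Rightarrow> 'a::complex_hilbert \<Rightarrow> ('i, 'a) ell2"
  is "\<lambda>\<xi> h i. \<xi> i *\<^sub>C h"
  by (simp add: norm_scaleC power_mult_distrib summable_on_cmult_left)

lift_definition ket :: "'i \<Rightarrow> ('i, complex) ell2" is "\<lambda>i j. if j = i then 1 else 0"
proof -
  fix i :: 'i
  have "(\<lambda>j. (norm (if j = i then 1 else 0 :: complex))\<^sup>2) summable_on UNIV
      \<longleftrightarrow> (\<lambda>j. (norm (if j = i then 1 else 0 :: complex))\<^sup>2) summable_on {i}"
    by (rule summable_on_cong_neutral) auto
  then show "(\<lambda>j. (norm (if j = i then 1 else 0 :: complex))\<^sup>2) summable_on UNIV" by simp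
qed


section \<open>Bounded operators\<close>

typedef (overloaded) ('a::complex_hilbert, 'b::complex_hilbert) bop =
  "{T :: 'a \<Rightarrow> 'b. bounded_linear T \<and> (\<forall>c x. T (c *\<^sub>C x) = c *\<^sub>C T x)}"
  morphisms app Abs_bop
proof
  have "c *\<^sub>C (0::'b) = 0" for c using scaleC_add_right[of c "0::'b" 0] by simp
  then show "(\<lambda>_. 0) \<in> {T :: 'a \<Rightarrow> 'b. bounded_linear T \<and> (\<forall>c x. T (c *\<^sub>C x) = c *\<^sub>C T x)}"
    by simp
qed

setup_lifting type_definition_bop

lemma scaleC_zero_right [simp]: "c *\<^sub>C (0::'a::complex_vector) = 0"
  using scaleC_add_right[of c 0 0] by simp

lemma scaleC_minus_right: "c *\<^sub>C (- x) = - (c *\<^sub>C (x::'a::complex_vector))"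
  using scaleC_add_right[of c x "- x"] by (simp add: minus_unique)

lemma scaleC_diff_right: "c *\<^sub>C (x - y) = c *\<^sub>C x - c *\<^sub>C (y::'a::complex_vector)"
  using scaleC_add_right[of c x "- y"] by (simp add: scaleC_minus_right)

lemma scaleR_scaleC_commute: "r *\<^sub>R c *\<^sub>C x = c *\<^sub>C r *\<^sub>R (x::'a::complex_vector)"
  by (metis scaleC_of_real scaleC_scaleC mult.commute)

lemma bounded_linear_scaleC: "bounded_linear (\<lambda>x::'a::complex_hilbert. c *\<^sub>C x)"
  by (rule bounded_linear_intro[of _ "cmod c"])
    (auto simp: scaleC_add_right scaleR_scaleC_commute norm_scaleC)

instantiation bop :: (complex_hilbert, complex_hilbert) complex_vector
begin

lift_definition zero_bop :: "('a, 'b) bop" is "\<lambda>_. 0" by simp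

lift_definition plus_bop :: "('a, 'b) bop \<Rightarrow> ('a, 'b) bop \<Rightarrow> ('a, 'b) bop"
  is "\<lambda>S T x. S x + T x" by (simp add: bounded_linear_add scaleC_add_right)

lift_definition uminus_bop :: "('a, 'b) bop \<Rightarrow> ('a, 'b) bop"
  is "\<lambda>T x. - T x" by (simp add: bounded_linear_minus scaleC_minus_right)

lift_definition minus_bop :: "('a, 'b) bop \<Rightarrow> ('a, 'b) bop \<Rightarrow> ('a, 'b) bop"
  is "\<lambda>S T x. S x - T x" by (simp add: bounded_linear_sub scaleC_diff_right)

lift_definition scaleC_bop :: "complex \<Rightarrow> ('a, 'b) bop \<Rightarrow> ('a, 'b) bop"
  is "\<lambda>c T x. c *\<^sub>C T x"
  by (auto intro: bounded_linear_compose[OF bounded_linear_scaleC] simp: scaleC_scaleC mult.commute)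

lift_definition scaleR_bop :: "real \<Rightarrow> ('a, 'b) bop \<Rightarrow> ('a, 'b) bop"
  is "\<lambda>r T x. r *\<^sub>R T x"
  by (auto intro: bounded_linear_const_scaleR simp: scaleR_scaleC_commute)

instance
  by standard
    (transfer; auto simp: algebra_simps scaleC_add_right scaleC_add_left scaleC_scaleC scaleC_of_real)+

end

lemma bounded_linear_app: "bounded_linear (app T)"
  using app[of T] by simp

instantiation bop :: (complex_hilbert, complex_hilbert) real_normed_vector
begin

definition norm_bop :: "('a, 'b) bop \<Rightarrow> real" where
  "norm_bop T = onorm (app T)"

definition dist_bop :: "('a, 'b) bop \<Rightarrow> ('a, 'b) bop \<Rightarrow> real" where
  "dist_bop S T = norm (S - T)"

definition sgn_bop :: "('a, 'b) bop \<Rightarrow> ('a, 'b) bop" where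
  "sgn_bop T = inverse (norm T) *\<^sub>R T"

definition uniformity_bop :: "(('a, 'b) bop \<times> ('a, 'b) bop) filter" where
  "uniformity_bop = (INF e\<in>{0<..}. principal {(x, y). dist x y < e})"

definition open_bop :: "('a, 'b) bop set \<Rightarrow> bool" where
  "open_bop U = (\<forall>x\<in>U. \<forall>\<^sub>F (x', y) in uniformity. x' = x \<longrightarrow> y \<in> U)"

instance
proof
  fix S T :: "('a, 'b) bop" and r :: real
  show "dist S T = norm (S - T)" by (rule dist_bop_def)
  show "sgn S = S /\<^sub>R norm S" by (rule sgn_bop_def)
  show "uniformity = (INF e\<in>{0<..}. principal {(x, y::('a, 'b) bop). dist x y < e})"
    by (rule uniformity_bop_def)
  show "open U = (\<forall>x\<in>U. \<forall>\<^sub>F (x', y) in uniformity. x' = x \<longrightarrow> y \<in> U)"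
    for U :: "('a, 'b) bop set" by (rule open_bop_def)
  show "(norm S = 0) = (S = 0)"
    unfolding norm_bop_def onorm_eq_0[OF bounded_linear_app]
    by (auto simp: zero_bop.rep_eq app_inject[symmetric])
  show "norm (S + T) \<le> norm S + norm T"
    unfolding norm_bop_def plus_bop.rep_eq by (intro onorm_triangle bounded_linear_app)
  show "norm (r *\<^sub>R S) = \<bar>r\<bar> * norm S"
    unfolding norm_bop_def scaleR_bop.rep_eq by (intro onorm_scaleR bounded_linear_app)
qed

end

lift_definition id_op :: "('a::complex_hilbert, 'a) bop" is "\<lambda>x. x" by simp

lift_definition comp_op ::
  "('b::complex_hilbert, 'c::complex_hilbert) bop \<Rightarrow> ('a::complex_hilbert, 'b) bop \<Rightarrow> ('a, 'c) bop"
  (infixl "\<circ>\<^sub>O" 70) is "\<lambda>S T x. S (T x)"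
  by (simp add: bounded_linear_compose)

definition adj :: "('a::complex_hilbert, 'b::complex_hilbert) bop \<Rightarrow> ('b, 'a) bop" where
  "adj T = (THE R. \<forall>x y. cinner (app T x) y = cinner x (app R y))"

definition positive_op :: "('a::complex_hilbert, 'a) bop \<Rightarrow> bool" where
  "positive_op T \<longleftrightarrow> (\<forall>x. cinner (app T x) x \<in> \<real>\<^sub>\<ge>\<^sub>0)"

definition sqrt_op :: "('a::complex_hilbert, 'a) bop \<Rightarrow> ('a, 'a) bop" where
  "sqrt_op T = (THE R. positive_op R \<and> R \<circ>\<^sub>O R = T)"

text \<open>\<open>amplify A\<close> is \<open>A \<otimes> I\<close>; a bounded operator is determined by its action on elementary
  tensors because their span is dense.\<close>

definition amplify ::
  "(('i, complex) ell2, ('i, complex) ell2) bop \<Rightarrow> (('i, 'a) ell2, ('i, 'a::complex_hilbert) ell2) bop"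
where
  "amplify A = (THE T. \<forall>\<xi> h. app T (tensor_vec \<xi> h) = tensor_vec (app A \<xi>) h)"

definition subalgebra :: "('a::complex_hilbert, 'a) bop set \<Rightarrow> bool" where
  "subalgebra B \<longleftrightarrow> (\<forall>S\<in>B. \<forall>T\<in>B. S + T \<in> B \<and> S \<circ>\<^sub>O T \<in> B) \<and> (\<forall>c. \<forall>T\<in>B. c *\<^sub>C T \<in> B)"


section \<open>Fock space and the noncommutative disc algebra\<close>

text \<open>The finite type \<open>'n\<close> indexes the \<open>n = CARD('n)\<close> generators, so words in the free semigroup
  are lists over \<open>'n\<close>, the identity being the empty list. The full Fock space is identified with
  the square-summable families over words through its orthonormal basis \<open>e\<^sub>\<alpha>\<close>, which is
  \<^term>\<open>ket \<alpha>\<close>; tensoring by \<open>e\<^sub>i\<close> on the left prepends the letter \<open>i\<close>.\<close>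

type_synonym 'n fock = "('n list, complex) ell2"

lift_definition creation :: "'n \<Rightarrow> ('n fock, 'n fock) bop"
  is "\<lambda>i \<xi>. Abs_ell2 (\<lambda>\<alpha>. case \<alpha> of [] \<Rightarrow> 0 | j # \<beta> \<Rightarrow> if j = i then coord \<xi> \<beta> else 0)"
proof -
  fix i :: 'n
  let ?S = "\<lambda>v \<alpha>. case \<alpha> of [] \<Rightarrow> 0 | j # \<beta> \<Rightarrow> if j = i then v \<beta> else (0::complex)"
  let ?g = "\<lambda>\<xi> \<alpha>. (norm (?S (coord \<xi>) \<alpha>))\<^sup>2"
  have hs: "(?g \<xi> has_sum (norm \<xi>)\<^sup>2) UNIV" for \<xi> :: "'n fock"
  proof -
    have "((\<lambda>\<beta>. (norm (coord \<xi> \<beta>))\<^sup>2) has_sum (norm \<xi>)\<^sup>2) UNIV"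
      unfolding norm_ell2_square by (intro has_sum_infsum coord_square_summable)
    then have "(?g \<xi> has_sum (norm \<xi>)\<^sup>2) (range ((#) i))"
      by (subst has_sum_reindex) (auto simp: o_def inj_on_def)
    moreover have "(?g \<xi> has_sum (norm \<xi>)\<^sup>2) (range ((#) i)) = (?g \<xi> has_sum (norm \<xi>)\<^sup>2) UNIV"
      by (rule has_sum_cong_neutral) (auto split: list.splits if_splits)
    ultimately show ?thesis by simp
  qed
  have c: "coord (Abs_ell2 (?S (coord \<xi>))) = ?S (coord \<xi>)" for \<xi> :: "'n fock"
    using has_sum_imp_summable[OF hs[of \<xi>]] by (simp add: Abs_ell2_inverse)
  have n: "norm (Abs_ell2 (?S (coord \<xi>))) = norm \<xi>" for \<xi> :: "'n fock"
    by (subst norm_ell2_def) (simp add: c infsumI[OF hs])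
  show "bounded_linear (\<lambda>\<xi>. Abs_ell2 (?S (coord \<xi>)))
      \<and> (\<forall>a \<xi>. Abs_ell2 (?S (coord (a *\<^sub>C \<xi>))) = a *\<^sub>C Abs_ell2 (?S (coord \<xi>)))"
  proof (intro conjI allI bounded_linear_intro[where K = 1])
    show "Abs_ell2 (?S (coord (\<xi> + \<eta>))) = Abs_ell2 (?S (coord \<xi>)) + Abs_ell2 (?S (coord \<eta>))"
      for \<xi> \<eta> :: "'n fock"
      by (rule coord_inject[THEN iffD1])
        (auto simp: c plus_ell2.rep_eq fun_eq_iff split: list.splits)
    show "Abs_ell2 (?S (coord (r *\<^sub>R \<xi>))) = r *\<^sub>R Abs_ell2 (?S (coord \<xi>))"
      for r and \<xi> :: "'n fock"
      by (rule coord_inject[THEN iffD1])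
        (auto simp: c scaleR_ell2.rep_eq fun_eq_iff split: list.splits)
    show "Abs_ell2 (?S (coord (a *\<^sub>C \<xi>))) = a *\<^sub>C Abs_ell2 (?S (coord \<xi>))"
      for a and \<xi> :: "'n fock"
      by (rule coord_inject[THEN iffD1])
        (auto simp: c scaleC_ell2.rep_eq fun_eq_iff split: list.splits)
    show "norm (Abs_ell2 (?S (coord \<xi>))) \<le> norm \<xi> * 1" for \<xi> :: "'n fock"
      by (simp add: n)
  qed
qed

definition creation_tuple :: "('n::finite fock, 'n fock) bop ^ 'n" where
  "creation_tuple = (\<chi> i. creation i)"

definition disc_algebra :: "('n fock, 'n fock) bop set" where
  "disc_algebra = (\<lambda>B. closed B \<and> subalgebra B) hull (insert id_op (range creation))"

definition adj_disc_algebra_plus :: "('n fock, 'n fock) bop set" where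
  "adj_disc_algebra_plus = {adj h + g | h g. h \<in> disc_algebra \<and> g \<in> disc_algebra}"


section \<open>Operator balls and the Poisson transform\<close>

definition row_ball :: "(('h::complex_hilbert, 'h) bop ^ 'n::finite) set" where
  "row_ball = {X. norm (\<Sum>i\<in>UNIV. X $ i \<circ>\<^sub>O adj (X $ i)) < 1}"

definition row_cball :: "(('h::complex_hilbert, 'h) bop ^ 'n::finite) set" where
  "row_cball = {X. norm (\<Sum>i\<in>UNIV. X $ i \<circ>\<^sub>O adj (X $ i)) \<le> 1}"

fun word_op :: "('h::complex_hilbert, 'h) bop ^ 'n::finite \<Rightarrow> 'n list \<Rightarrow> ('h, 'h) bop" where
  "word_op X [] = id_op"
| "word_op X (i # \<alpha>) = X $ i \<circ>\<^sub>O word_op X \<alpha>"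

definition defect_op :: "('h::complex_hilbert, 'h) bop ^ 'n::finite \<Rightarrow> ('h, 'h) bop" where
  "defect_op X = sqrt_op (id_op - (\<Sum>i\<in>UNIV. X $ i \<circ>\<^sub>O adj (X $ i)))"

definition poisson_kernel ::
  "('h::complex_hilbert, 'h) bop ^ 'n::finite \<Rightarrow> ('h, ('n list, 'h) ell2) bop" where
  "poisson_kernel X =
    Abs_bop (\<lambda>h. \<Sum>\<^sub>\<infinity>\<alpha>. tensor_vec (ket \<alpha>) (app (defect_op X \<circ>\<^sub>O adj (word_op X \<alpha>)) h))"

definition poisson ::
  "('n::finite fock, 'n fock) bop \<Rightarrow> ('h::complex_hilbert, 'h) bop ^ 'n \<Rightarrow> ('h, 'h) bop" where
  "poisson A X = adj (poisson_kernel X) \<circ>\<^sub>O amplify A \<circ>\<^sub>O poisson_kernel X"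


section \<open>Free holomorphic and free pluriharmonic functions\<close>

text \<open>A free holomorphic function is given by its coefficients; it is evaluated on every Hilbert
  space by the norm-convergent series \<open>free_eval\<close>. The exponent for \<open>k = 0\<close> is irrelevant.\<close>

definition free_holomorphic :: "('n::finite list \<Rightarrow> complex) \<Rightarrow> bool" where
  "free_holomorphic a \<longleftrightarrow>
    limsup (\<lambda>k. ereal ((\<Sum>\<alpha> | length \<alpha> = k. (cmod (a \<alpha>))\<^sup>2) powr (1 / (2 * real k)))) \<le> 1"

definition free_eval ::
  "('n::finite list \<Rightarrow> complex) \<Rightarrow> ('h::complex_hilbert, 'h) bop ^ 'n \<Rightarrow> ('h, 'h) bop" where
  "free_eval a X = (\<Sum>k. \<Sum>\<alpha> | length \<alpha> = k. a \<alpha> *\<^sub>C word_op X \<alpha>)"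

definition Re_op :: "('h::complex_hilbert, 'h) bop \<Rightarrow> ('h, 'h) bop" where
  "Re_op T = (1 / 2) *\<^sub>C (T + adj T)"

text \<open>Over the single Hilbert space \<open>'h\<close>, \<open>u\<close> is \<open>Re F\<^sub>1 + i Re F\<^sub>2\<close>, where \<open>F\<^sub>1, F\<^sub>2\<close> have
  coefficients \<open>a, b\<close>. A free pluriharmonic function has one pair \<open>a, b\<close> serving all Hilbert
  spaces. Since types cannot be quantified below an existential, this is expressed by choosing
  \<open>a, b\<close> over the Fock space and requiring that any such choice also serves an arbitrary \<open>'h\<close>.\<close>

definition is_pluriharmonic_with ::
  "('n::finite list \<Rightarrow> complex) \<Rightarrow> ('n list \<Rightarrow> complex)
    \<Rightarrow> (('h::complex_hilbert, 'h) bop ^ 'n \<Rightarrow> ('h, 'h) bop) \<Rightarrow> bool" where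
  "is_pluriharmonic_with a b u \<longleftrightarrow>
    free_holomorphic a \<and> free_holomorphic b \<and>
    (\<forall>X\<in>row_ball. u X = Re_op (free_eval a X) + \<i> *\<^sub>C Re_op (free_eval b X))"

definition is_continuous_extension ::
  "(('h::complex_hilbert, 'h) bop ^ 'n::finite \<Rightarrow> ('h, 'h) bop)
    \<Rightarrow> (('h, 'h) bop ^ 'n \<Rightarrow> ('h, 'h) bop) \<Rightarrow> bool" where
  "is_continuous_extension u v \<longleftrightarrow> continuous_on row_cball v \<and> (\<forall>X\<in>row_ball. v X = u X)"

end

theory Submission
  imports Defs
begin

text \<open>For \<open>X\<close> in the open ball the Poisson kernel is an isometry and its adjoint intertwines
  \<open>S\<^sub>i \<otimes> I\<close> with \<open>X\<^sub>i\<close>. Hence \<open>P[S\<^sub>\<alpha>](X) = X\<^sub>\<alpha>\<close>, and since \<open>\<parallel>A \<otimes> I\<parallel> \<le> \<parallel>A\<parallel>\<close>, the transform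
  is contractive (von Neumann's inequality). Polynomials in the \<open>S\<^sub>i\<close> are dense in the disc
  algebra, so \<open>P[g]\<close> is a uniform limit of polynomials \<open>p(X)\<close>, which are norm continuous on
  the closed ball and take the value \<open>p(S)\<close> at \<open>S\<close>; the coefficients of \<open>P[g]\<close> are the
  coordinates of \<open>g 1\<close>. For \<open>f = h\<^sup>* + g\<close> with \<open>G = P[g]\<close>, \<open>H = P[h]\<close> one has
  \<open>P[f] = H\<^sup>* + G = Re (G + H) + i Re (- i (G - H))\<close>. The representation is unique up to imaginary
  constants, as one sees by evaluating at \<open>S / 2\<close>.\<close>

section \<open>Complex Hilbert spaces\<close>

text \<open>The adjoint, the square root and \<open>amplify\<close> are definite descriptions, so
  each needs existence and uniqueness before it can be used. Square roots are only taken of I - T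
  with \<open>norm T < 1\<close>: for T = \<open>row_op X\<close> with X in the open ball, and for T
  = A^* A with \<open>norm A < 1\<close>, the general A following by scaling. A fixed point argument
  then takes the place of the functional calculus.

  The closed ball is reached radially: r X lies in the open ball for 0 <= r < 1. Hence every
  continuous extension of P[f], not only the constructed one, is bounded by \<open>norm f\<close>.
  This yields both the uniqueness of the extension and the uniform convergence that builds it, so
  (ii) holds for any extension.

  Uniqueness of the coefficients matters because every pair that works over the Fock space has to
  work over the other space as well. The tuple S is only known to lie in the closed ball, so S / 2
  replaces it; its matrix entries still display each coefficient up to a power of 2.\<close>

lemma scaleC_zero_left [simp]: "0 *\<^sub>C (x::'a::complex_vector) = 0"
  using scaleC_of_real[of 0 x] by simp

lemma bounded_bilinear_cinner: "bounded_bilinear (cinner :: 'a::complex_hilbert \<Rightarrow> 'a \<Rightarrow> complex)"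
proof
  fix a a' b b' :: 'a and r :: real
  show "cinner (a + a') b = cinner a b + cinner a' b" by (rule cinner_add_left)
  show "cinner a (b + b') = cinner a b + cinner a b'"
    by (metis cinner_commute cinner_add_left complex_cnj_add)
  show "cinner (r *\<^sub>R a) b = r *\<^sub>R cinner a b"
    by (simp add: scaleC_of_real[symmetric] cinner_scaleC_left scaleC_complex_def)
  show "cinner a (r *\<^sub>R b) = r *\<^sub>R cinner a b"
    by (simp add: scaleC_of_real[symmetric] cinner_scaleC_right scaleC_complex_def)
  show "\<exists>K. \<forall>a b::'a. norm (cinner a b) \<le> norm a * norm b * K"
    by (intro exI[of _ 1]) (simp add: cinner_Cauchy_Schwarz)
qed

interpretation cinner: bounded_bilinear "cinner :: 'a::complex_hilbert \<Rightarrow> 'a \<Rightarrow> complex"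
  by (rule bounded_bilinear_cinner)

lemma cinner_eqI:
  assumes "\<And>z. cinner x z = cinner y (z::'a::complex_hilbert)"
  shows "x = y"
proof -
  have "cinner (x - y) (x - y) = 0" using assms[of "x - y"] by (simp add: cinner_diff_left)
  then show ?thesis by (simp add: cinner_self)
qed

lemma norm_le_cinnerI:
  fixes x :: "'a::complex_hilbert"
  assumes "\<And>y. cmod (cinner x y) \<le> B * norm y" and "0 \<le> B"
  shows "norm x \<le> B"
proof (cases "x = 0")
  case False
  have "(norm x)\<^sup>2 \<le> B * norm x"
    using assms(1)[of x] by (simp add: cinner_self norm_power)
  then show ?thesis using False by (simp add: power2_eq_square)
qed (use assms in simp)

lemma norm_square_add:
  "(norm (x + y::'a::complex_hilbert))\<^sup>2 = (norm x)\<^sup>2 + (norm y)\<^sup>2 + 2 * Re (cinner x y)"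
proof -
  have "complex_of_real ((norm (x + y))\<^sup>2) = of_real ((norm x)\<^sup>2) + of_real ((norm y)\<^sup>2)
      + (cinner x y + cnj (cinner x y))"
    unfolding cinner_self[symmetric] cinner_commute[of x y, symmetric]
    by (simp add: cinner.add_left cinner.add_right cinner_commute[of y x, symmetric])
  then have "Re (complex_of_real ((norm (x + y))\<^sup>2)) = Re (of_real ((norm x)\<^sup>2) + of_real ((norm y)\<^sup>2)
      + (cinner x y + cnj (cinner x y)))" by (rule arg_cong)
  then show ?thesis by simp
qed

lemma parallelogram_law:
  "(norm (x + y))\<^sup>2 + (norm (x - y::'a::complex_hilbert))\<^sup>2 = 2 * (norm x)\<^sup>2 + 2 * (norm y)\<^sup>2"
  using norm_square_add[of x y] norm_square_add[of x "- y"] by (simp add: cinner.minus_right)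

text \<open>The representing vector minimises \<open>\<parallel>x\<parallel>\<^sup>2 - 2 Re (\<phi> x)\<close>; by the parallelogram law every
  minimising sequence is Cauchy.\<close>

lemma Riesz_representation:
  fixes \<phi> :: "'a::complex_hilbert \<Rightarrow> complex"
  assumes bl: "bounded_linear \<phi>" and C: "\<And>c x. \<phi> (c *\<^sub>C x) = c * \<phi> x"
  shows "\<exists>z. \<forall>x. \<phi> x = cinner x z"
proof -
  interpret bounded_linear \<phi> by (rule bl)
  obtain K where K: "\<And>x. cmod (\<phi> x) \<le> norm x * K" "K > 0" using pos_bounded by blast
  define J where "J x = (norm x)\<^sup>2 - 2 * Re (\<phi> x)" for x
  have lower: "- K\<^sup>2 \<le> J x" for x
  proof -
    have "0 \<le> (norm x - K)\<^sup>2" by simp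
    moreover have "Re (\<phi> x) \<le> norm x * K" using K(1)[of x] complex_Re_le_cmod order_trans by blast
    ultimately show ?thesis by (simp add: J_def power2_diff)
  qed
  then have bdd: "bdd_below (range J)" by (intro bdd_belowI2)
  define m where "m = Inf (range J)"
  have m: "m \<le> J x" for x unfolding m_def using bdd by (simp add: cInf_lower)
  have "\<exists>x. J x < m + 1 / Suc n" for n
    using cInf_less_iff[of "range J" "m + 1 / Suc n"] bdd by (auto simp: m_def)
  then obtain X where X: "\<And>n. J (X n) < m + 1 / Suc n" by metis
  \<comment> \<open>J is at least m at the midpoint of x and y too; inserted into the parallelogram
    law, this bounds their distance.\<close>
  have mid: "(norm (x - y))\<^sup>2 \<le> 2 * (J x - m) + 2 * (J y - m)" for x y
  proof -
    have "(norm ((1/2) *\<^sub>R (x + y)))\<^sup>2 = (1/4) * (norm (x + y))\<^sup>2"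
      by (simp add: power_mult_distrib power2_eq_square)
    moreover have "Re (\<phi> ((1/2) *\<^sub>R (x + y))) = (1/2) * (Re (\<phi> x) + Re (\<phi> y))"
      by (simp add: scaleR add)
    ultimately have "4 * J ((1/2) *\<^sub>R (x + y)) = (norm (x + y))\<^sup>2 - 4 * (Re (\<phi> x) + Re (\<phi> y))"
      by (simp add: J_def)
    with m[of "(1/2) *\<^sub>R (x + y)"] parallelogram_law[of x y] show ?thesis
      by (simp add: J_def)
  qed
  have "Cauchy X"
  proof (rule CauchyI)
    fix e :: real assume e: "0 < e"
    obtain N where N: "inverse (of_nat (Suc N)) < e\<^sup>2 / 4"
      using reals_Archimedean[of "e\<^sup>2 / 4"] e by auto
    have "norm (X i - X j) < e" if "i \<ge> N" "j \<ge> N" for i j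
    proof -
      have s: "J (X k) - m < inverse (of_nat (Suc N))" if "k \<ge> N" for k
      proof -
        have "J (X k) - m < 1 / Suc k" using X[of k] by linarith
        also have "\<dots> \<le> inverse (of_nat (Suc N))" using that by (simp add: field_simps)
        finally show ?thesis .
      qed
      have "(norm (X i - X j))\<^sup>2 < 4 * inverse (of_nat (Suc N))"
        using mid[of "X i" "X j"] s[OF that(1)] s[OF that(2)] by argo
      also have "\<dots> < e\<^sup>2" using N by simp
      finally show ?thesis using e by (simp add: power2_less_imp_less)
    qed
    then show "\<exists>M. \<forall>m\<ge>M. \<forall>n\<ge>M. norm (X m - X n) < e" by blast
  qed
  then obtain z where z: "X \<longlonglongrightarrow> z" using Cauchy_convergent convergent_def by blast
  have "(\<lambda>n. J (X n)) \<longlonglongrightarrow> J z"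
    unfolding J_def by (intro tendsto_intros z tendsto)
  moreover have "(\<lambda>n. m + 1 / Suc n) \<longlonglongrightarrow> m + 0"
    by (intro tendsto_intros LIMSEQ_Suc[OF lim_1_over_n])
  ultimately have Jz: "J z \<le> m"
    using X by (intro LIMSEQ_le[of "\<lambda>n. J (X n)" _ "\<lambda>n. m + 1 / Suc n"]) (auto intro: less_imp_le)
  \<comment> \<open>Stationarity at the minimum: J (z + t x) - J z is a quadratic in t whose linear
    coefficient 2 d must vanish.\<close>
  have key: "Re (cinner x z) = Re (\<phi> x)" for x
  proof -
    define d where "d = Re (cinner x z) - Re (\<phi> x)"
    have ineq: "0 \<le> t\<^sup>2 * (norm x)\<^sup>2 + 2 * t * d" for t :: real
    proof -
      have "J z \<le> J (z + t *\<^sub>R x)" using Jz m order_trans by blast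
      moreover have "Re (cinner z (t *\<^sub>R x)) = t * Re (cinner x z)"
        by (subst cinner_commute) (simp add: cinner.scaleR_left)
      ultimately show ?thesis
        using norm_square_add[of z "t *\<^sub>R x"]
        by (simp add: J_def d_def add scaleR power_mult_distrib algebra_simps)
    qed
    show ?thesis
    proof (cases "x = 0")
      case False
      then have n: "(norm x)\<^sup>2 > 0" by simp
      define N where "N = (norm x)\<^sup>2"
      \<comment> \<open>t = - d / N is the vertex of that quadratic.\<close>
      have "0 \<le> (- d / N)\<^sup>2 * N + 2 * (- d / N) * d" unfolding N_def by (rule ineq)
      also have "\<dots> = - (d\<^sup>2 / N)" using n by (simp add: N_def[symmetric] power2_eq_square field_simps)
      finally have "d\<^sup>2 / N \<le> 0" by simp
      then have "d = 0" using n by (simp add: N_def divide_le_0_iff)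
      then show ?thesis by (simp add: d_def)
    qed (simp add: zero)
  qed
  \<comment> \<open>A complex linear functional is determined by its real part: Im (\<phi> x) = - Re
    (\<phi> (i x)).\<close>
  have "\<phi> x = cinner x z" for x
  proof (rule complex_eqI)
    show "Re (\<phi> x) = Re (cinner x z)" using key by simp
    show "Im (\<phi> x) = Im (cinner x z)"
      using key[of "\<i> *\<^sub>C x"] by (simp add: C cinner_scaleC_left)
  qed
  then show ?thesis by blast
qed

section \<open>Bounded operators\<close>

lemma bop_eqI: "(\<And>x. app S x = app T x) \<Longrightarrow> S = T"
  by (rule app_inject[THEN iffD1]) auto

lemma app_bounded_linear_simps:
  shows app_add_right: "app T (x + y) = app T x + app T y"
    and app_zero_right [simp]: "app T 0 = 0"
    and app_scaleR_right: "app T (r *\<^sub>R x) = r *\<^sub>R app T x"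
  using bounded_linear_app[of T]
  by (simp_all add: linear_simps linear_sum bounded_linear.linear)

lemma app_scaleC_right: "app T (c *\<^sub>C x) = c *\<^sub>C app T x"
  using app[of T] by simp

lemma app_sum_left: "app (sum g I) x = (\<Sum>i\<in>I. app (g i) x)"
  by (induction I rule: infinite_finite_induct) (simp_all add: zero_bop.rep_eq plus_bop.rep_eq)

lemmas app_op_simps = zero_bop.rep_eq plus_bop.rep_eq uminus_bop.rep_eq minus_bop.rep_eq
  scaleC_bop.rep_eq scaleR_bop.rep_eq id_op.rep_eq comp_op.rep_eq app_sum_left

lemma norm_app_le: "norm (app T x) \<le> norm T * norm x"
  unfolding norm_bop_def by (rule onorm[OF bounded_linear_app])

lemma norm_bop_leI:
  assumes "\<And>x. norm (app T x) \<le> B * norm x" "0 \<le> B"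
  shows "norm T \<le> B"
  unfolding norm_bop_def using assms(2,1) by (rule onorm_bound)

lemma app_Abs_bop:
  assumes "\<And>x y. T (x + y) = T x + T y" "\<And>c x. T (c *\<^sub>C x) = c *\<^sub>C T x"
    "\<And>x. norm (T x) \<le> B * norm x"
  shows "app (Abs_bop T) = T"
proof (rule Abs_bop_inverse)
  have "bounded_linear T"
    by (rule bounded_linear_intro[where K = B])
      (simp_all add: assms scaleC_of_real[symmetric] mult.commute)
  then show "T \<in> {T. bounded_linear T \<and> (\<forall>c x. T (c *\<^sub>C x) = c *\<^sub>C T x)}"
    using assms by simp
qed

lemma bounded_bilinear_comp_op:
  "bounded_bilinear (comp_op :: ('b::complex_hilbert, 'c::complex_hilbert) bop
    \<Rightarrow> ('a::complex_hilbert, 'b) bop \<Rightarrow> ('a, 'c) bop)"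
proof
  fix a a' :: "('b, 'c) bop" and b b' :: "('a, 'b) bop" and r :: real
  show "(a + a') \<circ>\<^sub>O b = a \<circ>\<^sub>O b + a' \<circ>\<^sub>O b" by (rule bop_eqI) (simp add: app_op_simps)
  show "a \<circ>\<^sub>O (b + b') = a \<circ>\<^sub>O b + a \<circ>\<^sub>O b'" by (rule bop_eqI) (simp add: app_op_simps app_add_right)
  show "(r *\<^sub>R a) \<circ>\<^sub>O b = r *\<^sub>R (a \<circ>\<^sub>O b)" by (rule bop_eqI) (simp add: app_op_simps)
  show "a \<circ>\<^sub>O (r *\<^sub>R b) = r *\<^sub>R (a \<circ>\<^sub>O b)" by (rule bop_eqI) (simp add: app_op_simps app_scaleR_right)
  show "\<exists>K. \<forall>(a::('b, 'c) bop) b::('a, 'b) bop. norm (a \<circ>\<^sub>O b) \<le> norm a * norm b * K"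
  proof (intro exI[of _ 1] allI norm_bop_leI)
    fix a :: "('b, 'c) bop" and b :: "('a, 'b) bop" and x
    have "norm (app (a \<circ>\<^sub>O b) x) \<le> norm a * norm (app b x)"
      by (simp add: comp_op.rep_eq norm_app_le)
    also have "\<dots> \<le> norm a * (norm b * norm x)" by (intro mult_left_mono norm_app_le) simp
    finally show "norm (app (a \<circ>\<^sub>O b) x) \<le> norm a * norm b * 1 * norm x" by (simp add: mult.assoc)
  qed simp
qed

interpretation comp_op: bounded_bilinear
  "comp_op :: ('b::complex_hilbert, 'c::complex_hilbert) bop \<Rightarrow> ('a::complex_hilbert, 'b) bop \<Rightarrow> ('a, 'c) bop"
  by (rule bounded_bilinear_comp_op)

lemma norm_comp_op_le: "norm (S \<circ>\<^sub>O T) \<le> norm S * norm T"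
proof (rule norm_bop_leI)
  fix x
  have "norm (app (S \<circ>\<^sub>O T) x) \<le> norm S * norm (app T x)"
    by (simp add: comp_op.rep_eq norm_app_le)
  also have "\<dots> \<le> norm S * (norm T * norm x)" by (intro mult_left_mono norm_app_le) simp
  finally show "norm (app (S \<circ>\<^sub>O T) x) \<le> norm S * norm T * norm x" by (simp add: mult.assoc)
qed simp

lemma comp_op_assoc: "R \<circ>\<^sub>O S \<circ>\<^sub>O T = R \<circ>\<^sub>O (S \<circ>\<^sub>O T)"
  by (rule bop_eqI) (simp add: comp_op.rep_eq)

lemma comp_id_op [simp]: "T \<circ>\<^sub>O id_op = T" "id_op \<circ>\<^sub>O T = T"
  by (rule bop_eqI, simp add: app_op_simps)+

lemma comp_op_scaleC: "(c *\<^sub>C S) \<circ>\<^sub>O T = c *\<^sub>C (S \<circ>\<^sub>O T)" "S \<circ>\<^sub>O (c *\<^sub>C T) = c *\<^sub>C (S \<circ>\<^sub>O T)"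
  by (rule bop_eqI, simp add: app_op_simps app_scaleC_right)+

section \<open>Norm and completeness of the operator spaces\<close>

lemma norm_scaleC_bop: "norm (c *\<^sub>C T :: ('a::complex_hilbert, 'b::complex_hilbert) bop) = cmod c * norm T"
proof -
  have le: "norm (c *\<^sub>C T) \<le> cmod c * norm T" for c and T :: "('a, 'b) bop"
  proof (rule norm_bop_leI)
    show "norm (app (c *\<^sub>C T) x) \<le> cmod c * norm T * norm x" for x
      using mult_left_mono[OF norm_app_le[of T x], of "cmod c"]
      by (simp add: app_op_simps norm_scaleC mult.assoc)
  qed simp
  show ?thesis
  proof (cases "c = 0")
    case True
    then show ?thesis using le[of c T] by simp
  next
    case False
    have "norm T = norm (inverse c *\<^sub>C c *\<^sub>C T)" using False by (simp add: scaleC_scaleC)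
    also have "\<dots> \<le> inverse (cmod c) * norm (c *\<^sub>C T)" using le by (simp add: norm_inverse[symmetric])
    finally show ?thesis using le[of c T] False by (simp add: field_simps)
  qed
qed

lemma bounded_linear_scaleC_bop:
  "bounded_linear (\<lambda>T :: ('a::complex_hilbert, 'b::complex_hilbert) bop. c *\<^sub>C T)"
  by (rule bounded_linear_intro[where K = "cmod c"])
    (simp_all add: scaleC_add_right scaleR_scaleC_commute norm_scaleC_bop mult.commute)

lemma bounded_linear_app_left:
  "bounded_linear (\<lambda>T :: ('a::complex_hilbert, 'b::complex_hilbert) bop. app T x)"
  by (rule bounded_linear_intro[where K = "norm x"]) (simp_all add: app_op_simps norm_app_le)

text \<open>Completeness is borrowed from the bounded real linear maps \<open>blinfun\<close>, whose
  norm is the same; complex homogeneity survives the pointwise limit.\<close>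

instance bop :: (complex_hilbert, complex_hilbert) banach
proof
  fix X :: "nat \<Rightarrow> ('a, 'b) bop"
  assume X: "Cauchy X"
  define Y where "Y n = Blinfun (app (X n))" for n
  have Y: "blinfun_apply (Y n) = app (X n)" for n
    by (simp add: Y_def bounded_linear_Blinfun_apply bounded_linear_app)
  have "norm (Y m - Y n) = norm (X m - X n)" for m n
  proof -
    have "blinfun_apply (Y m - Y n) = app (X m - X n)"
      by (simp add: fun_eq_iff minus_blinfun.rep_eq minus_bop.rep_eq Y)
    then show ?thesis by (simp add: norm_blinfun.rep_eq norm_bop_def)
  qed
  then have "Cauchy Y" using X by (simp add: Cauchy_iff)
  then obtain L where L: "Y \<longlonglongrightarrow> L" using Cauchy_convergent convergent_def by blast
  have pt: "(\<lambda>n. app (X n) x) \<longlonglongrightarrow> blinfun_apply L x" for x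
    using bounded_linear.tendsto[OF blinfun.bounded_linear_left L] by (simp add: Y)
  have "blinfun_apply L (c *\<^sub>C x) = c *\<^sub>C blinfun_apply L x" for c x
  proof (rule LIMSEQ_unique)
    show "(\<lambda>n. app (X n) (c *\<^sub>C x)) \<longlonglongrightarrow> blinfun_apply L (c *\<^sub>C x)" by (rule pt)
    show "(\<lambda>n. app (X n) (c *\<^sub>C x)) \<longlonglongrightarrow> c *\<^sub>C blinfun_apply L x"
      unfolding app_scaleC_right by (intro bounded_linear.tendsto[OF bounded_linear_scaleC] pt)
  qed
  then have T: "app (Abs_bop (blinfun_apply L)) = blinfun_apply L"
    by (simp add: Abs_bop_inverse blinfun.bounded_linear_right)
  have "norm (X n - Abs_bop (blinfun_apply L)) = norm (Y n - L)" for n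
  proof -
    have "blinfun_apply (Y n - L) = app (X n - Abs_bop (blinfun_apply L))"
      by (simp add: fun_eq_iff minus_blinfun.rep_eq minus_bop.rep_eq Y T)
    then show ?thesis by (simp add: norm_blinfun.rep_eq norm_bop_def)
  qed
  then have "X \<longlonglongrightarrow> Abs_bop (blinfun_apply L)"
    using L by (simp add: LIMSEQ_iff)
  then show "convergent X" by (auto simp: convergent_def)
qed

section \<open>Adjoints\<close>

text \<open>This gives the definite description \<open>adj\<close> its meaning: Riesz representation
  supplies the operator, nondegeneracy of the inner product its uniqueness.\<close>

lemma cinner_adj: "cinner (app T x) y = cinner x (app (adj T) y)"
proof -
  have "\<exists>z. \<forall>x. cinner (app T x) y = cinner x z" for y
  proof (rule Riesz_representation)
    show "bounded_linear (\<lambda>x. cinner (app T x) y)"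
      by (rule bounded_linear_compose[OF cinner.bounded_linear_left bounded_linear_app])
  qed (simp add: app_scaleC_right cinner_scaleC_left)
  then obtain R where R: "\<And>x y. cinner (app T x) y = cinner x (R y)" by metis
  have R': "cinner (R y) x = cinner y (app T x)" for x y
    by (metis R cinner_commute)
  have "app (Abs_bop R) = R"
  proof (rule app_Abs_bop)
    show "R (x + y) = R x + R y" for x y
      by (rule cinner_eqI) (simp add: R' cinner.add_left)
    show "R (c *\<^sub>C x) = c *\<^sub>C R x" for c x
      by (rule cinner_eqI) (simp add: R' cinner_scaleC_left)
    show "norm (R x) \<le> norm T * norm x" for x
    proof (rule norm_le_cinnerI)
      fix y
      have "cmod (cinner (R x) y) \<le> norm x * norm (app T y)"
        unfolding R' by (rule cinner_Cauchy_Schwarz)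
      also have "\<dots> \<le> norm x * (norm T * norm y)" by (intro mult_left_mono norm_app_le) simp
      finally show "cmod (cinner (R x) y) \<le> norm T * norm x * norm y" by (simp add: mult_ac)
    qed simp
  qed
  then have ex: "\<forall>x y. cinner (app T x) y = cinner x (app (Abs_bop R) y)" by (simp add: R)
  have "\<forall>x y. cinner (app T x) y = cinner x (app (adj T) y)"
    unfolding adj_def
  proof (rule theI[of "\<lambda>S. \<forall>x y. cinner (app T x) y = cinner x (app S y)", OF ex])
    fix S assume S: "\<forall>x y. cinner (app T x) y = cinner x (app S y)"
    show "S = Abs_bop R"
      by (rule bop_eqI, rule cinner_eqI) (metis S ex cinner_commute)
  qed
  then show ?thesis by blast
qed

lemma cinner_adj': "cinner (app (adj T) x) y = cinner x (app T y)"
  by (metis cinner_adj cinner_commute)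

lemma adj_eqI:
  assumes "\<And>x y. cinner (app T x) y = cinner x (app S y)"
  shows "adj T = S"
  by (rule bop_eqI, rule cinner_eqI) (metis assms cinner_adj cinner_commute)

lemma adj_adj [simp]: "adj (adj T) = T"
  by (rule adj_eqI) (rule cinner_adj')

lemma adj_add: "adj (S + T) = adj S + adj T"
  by (rule adj_eqI) (simp add: app_op_simps cinner.add_left cinner.add_right cinner_adj)

lemma adj_scaleC: "adj (c *\<^sub>C T) = cnj c *\<^sub>C adj T"
  by (rule adj_eqI) (simp add: app_op_simps cinner_scaleC_left cinner_scaleC_right cinner_adj)

lemma adj_scaleR: "adj (r *\<^sub>R T) = r *\<^sub>R adj T"
  by (rule adj_eqI) (simp add: app_op_simps cinner.scaleR_left cinner.scaleR_right cinner_adj)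

lemma adj_zero [simp]: "adj 0 = 0"
  by (rule adj_eqI) (simp add: app_op_simps cinner.zero_right)

lemma adj_id [simp]: "adj id_op = id_op"
  by (rule adj_eqI) (simp add: app_op_simps)

lemma adj_comp: "adj (S \<circ>\<^sub>O T) = adj T \<circ>\<^sub>O adj S"
  by (rule adj_eqI) (simp add: app_op_simps cinner_adj)

lemma adj_diff: "adj (S - T) = adj S - adj T"
  by (rule adj_eqI) (simp add: app_op_simps cinner.diff_left cinner.diff_right cinner_adj)

lemma adj_sum: "adj (sum g I) = (\<Sum>i\<in>I. adj (g i))"
  by (induction I rule: infinite_finite_induct) (simp_all add: adj_add)

lemma norm_adj [simp]: "norm (adj T) = norm T"
proof -
  have le: "norm (adj T) \<le> norm T" for T :: "('x::complex_hilbert, 'y::complex_hilbert) bop"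
  proof (rule norm_bop_leI)
    fix x show "norm (app (adj T) x) \<le> norm T * norm x"
    proof (rule norm_le_cinnerI)
      fix y
      have "cmod (cinner (app (adj T) x) y) \<le> norm x * norm (app T y)"
        unfolding cinner_adj' by (rule cinner_Cauchy_Schwarz)
      also have "\<dots> \<le> norm x * (norm T * norm y)" by (intro mult_left_mono norm_app_le) simp
      finally show "cmod (cinner (app (adj T) x) y) \<le> norm T * norm x * norm y" by (simp add: mult_ac)
    qed simp
  qed simp
  show ?thesis using le[of T] le[of "adj T"] by simp
qed

lemma bounded_linear_adj:
  "bounded_linear (adj :: ('a::complex_hilbert, 'b::complex_hilbert) bop \<Rightarrow> _)"
  by (rule bounded_linear_intro[where K = 1]) (simp_all add: adj_add adj_scaleR)

text \<open>Polarisation. Complex scalars are essential (a real rotation by a right angle is a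
  counterexample over the reals): replacing x by i x turns the sum of the two mixed terms into their
  difference.\<close>

lemma cinner_app_eq_zeroD:
  fixes T :: "('a::complex_hilbert, 'a) bop"
  assumes "\<And>x. cinner (app T x) x = 0"
  shows "T = 0"
proof (rule bop_eqI, rule cinner_eqI)
  fix x y
  have *: "cinner (app T x) y + cinner (app T y) x = 0" for x y
    using assms[of "x + y"] assms[of x] assms[of y]
    by (simp add: app_add_right cinner.add_left cinner.add_right add.commute)
  from *[of "\<i> *\<^sub>C x" y] have "\<i> * (cinner (app T x) y - cinner (app T y) x) = 0"
    by (simp add: app_scaleC_right cinner_scaleC_left cinner_scaleC_right algebra_simps)
  with *[of x y] show "cinner (app T x) y = cinner (app 0 x) y"
    by (simp add: app_op_simps)
qed

section \<open>Square roots of strictly positive operators\<close>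

text \<open>Writing the root as \<open>I - K\<close>, the equation \<open>(I - K)\<^sup>2 = I - T\<close> is the fixed point equation
  \<open>K = (T + K\<^sup>2) / 2\<close>, a contraction of the ball of radius \<open>1 - sqrt (1 - \<parallel>T\<parallel>)\<close>.\<close>

lemma sqrt_op_id_minus:
  fixes T :: "('a::complex_hilbert, 'a) bop"
  assumes adjT: "adj T = T" and T: "norm T < 1"
  defines "R \<equiv> sqrt_op (id_op - T)"
  shows "adj R = R" and "R \<circ>\<^sub>O R = id_op - T"
proof -
  \<comment> \<open>s is the smaller root of s = (\<open>norm T\<close> + s^2) / 2, so the ball of
    radius s is mapped into itself; s < 1 is also the Lipschitz constant there.\<close>
  define s where "s = 1 - sqrt (1 - norm T)"
  have s: "0 \<le> s" "s < 1" using T by (auto simp: s_def)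
  have "(1 - s)\<^sup>2 = 1 - norm T" using T by (simp add: s_def)
  then have s2: "(norm T + s\<^sup>2) / 2 = s" by (simp add: power2_diff)
  \<comment> \<open>Both side conditions are closed and inherited by the fixed point. Commuting with
    everything that commutes with T is what later makes any other root commute with this
    one.\<close>
  define S where "S = cball 0 s \<inter> {K. adj K = K} \<inter> (\<Inter>A\<in>{A. A \<circ>\<^sub>O T = T \<circ>\<^sub>O A}. {K. A \<circ>\<^sub>O K = K \<circ>\<^sub>O A})"
  define \<Phi> where "\<Phi> K = (1/2) *\<^sub>R (T + K \<circ>\<^sub>O K)" for K
  have "closed S"
    unfolding S_def
    by (intro closed_Int closed_cball closed_INT ballI closed_Collect_eq continuous_intros
        bounded_linear.continuous_on[OF bounded_linear_adj]
        bounded_linear.continuous_on[OF comp_op.bounded_linear_left]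
        bounded_linear.continuous_on[OF comp_op.bounded_linear_right])
  then have "complete S" by (simp add: complete_eq_closed)
  moreover have "0 \<in> S" using s by (simp add: S_def comp_op.zero_left comp_op.zero_right)
  moreover have "\<Phi> ` S \<subseteq> S"
  proof
    fix L assume "L \<in> \<Phi> ` S"
    then obtain K where K: "K \<in> S" and L: "L = \<Phi> K" by blast
    have "norm L \<le> (norm T + norm K * norm K) / 2"
      unfolding L \<Phi>_def using norm_triangle_ineq[of T "K \<circ>\<^sub>O K"] norm_comp_op_le[of K K] by simp
    also have "\<dots> \<le> (norm T + s\<^sup>2) / 2"
      unfolding power2_eq_square using K s
      by (intro divide_right_mono add_left_mono mult_mono) (auto simp: S_def)
    finally have "norm L \<le> s" using s2 by simp
    moreover have "adj L = L"
    proof -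
      have "adj K = K" using K by (simp add: S_def)
      then show ?thesis by (simp add: L \<Phi>_def adj_scaleR adj_add adj_comp adjT)
    qed
    moreover have "A \<circ>\<^sub>O L = L \<circ>\<^sub>O A" if A: "A \<circ>\<^sub>O T = T \<circ>\<^sub>O A" for A
    proof -
      have AK: "A \<circ>\<^sub>O K = K \<circ>\<^sub>O A" using K A by (auto simp: S_def)
      then have "A \<circ>\<^sub>O (K \<circ>\<^sub>O K) = K \<circ>\<^sub>O K \<circ>\<^sub>O A" by (metis comp_op_assoc)
      then show ?thesis using A
        by (simp add: L \<Phi>_def comp_op.scaleR_left comp_op.scaleR_right comp_op.add_left comp_op.add_right)
    qed
    ultimately show "L \<in> S" by (auto simp: S_def)
  qed
  moreover have "dist (\<Phi> K) (\<Phi> L) \<le> s * dist K L" if "K \<in> S" "L \<in> S" for K L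
  proof -
    have "\<Phi> K - \<Phi> L = (1/2) *\<^sub>R (K \<circ>\<^sub>O (K - L) + (K - L) \<circ>\<^sub>O L)"
      by (simp add: \<Phi>_def comp_op.diff_left comp_op.diff_right algebra_simps)
    then have "norm (\<Phi> K - \<Phi> L) \<le> (norm (K \<circ>\<^sub>O (K - L)) + norm ((K - L) \<circ>\<^sub>O L)) / 2"
      using norm_triangle_ineq[of "K \<circ>\<^sub>O (K - L)" "(K - L) \<circ>\<^sub>O L"] by simp
    also have "\<dots> \<le> (s * norm (K - L) + norm (K - L) * s) / 2"
      using that by (intro divide_right_mono add_mono order_trans[OF norm_comp_op_le] mult_right_mono mult_left_mono)
        (auto simp: S_def)
    finally show ?thesis by (simp add: dist_norm)
  qed
  ultimately have "\<exists>!K\<in>S. \<Phi> K = K"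
    using s by (intro Banach_fix[where c = s]) auto
  then obtain K where K: "K \<in> S" "\<Phi> K = K" by blast
  define B where "B = id_op - K"
  have "2 *\<^sub>R K = T + K \<circ>\<^sub>O K" using arg_cong[OF K(2), of "\<lambda>x. 2 *\<^sub>R x"] by (simp add: \<Phi>_def)
  then have BB: "B \<circ>\<^sub>O B = id_op - T"
    by (simp add: B_def comp_op.diff_left comp_op.diff_right scaleR_2 algebra_simps)
  have adjB: "adj B = B" using K by (simp add: B_def adj_diff S_def)
  \<comment> \<open>Strict positivity of B, from \<open>norm K \<le> s < 1\<close>; it also makes B
    + Q injective for positive Q in the uniqueness part.\<close>
  have lower: "(1 - s) * (norm x)\<^sup>2 \<le> Re (cinner (app B x) x)" for x
  proof -
    have "Re (cinner (app K x) x) \<le> norm (app K x) * norm x"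
      using cinner_Cauchy_Schwarz complex_Re_le_cmod order_trans by blast
    also have "\<dots> \<le> s * norm x * norm x"
      using K norm_app_le[of K x] by (intro mult_right_mono order_trans[OF norm_app_le]) (auto simp: S_def)
    finally show ?thesis
      by (simp add: B_def app_op_simps cinner.diff_left cinner_self power2_eq_square algebra_simps)
  qed
  have posB: "positive_op B"
    unfolding positive_op_def
  proof
    fix x
    have "cnj (cinner (app B x) x) = cinner (app B x) x"
      by (metis cinner_commute cinner_adj adjB)
    then have "cinner (app B x) x \<in> \<real>" by (simp add: Reals_cnj_iff)
    moreover have "0 \<le> Re (cinner (app B x) x)"
      using s by (intro order_trans[OF _ lower]) simp
    ultimately show "cinner (app B x) x \<in> \<real>\<^sub>\<ge>\<^sub>0"
      by (simp add: complex_nonneg_Reals_iff complex_is_Real_iff)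
  qed
  have "R = B"
    unfolding R_def sqrt_op_def
  proof (rule the_equality)
    show "positive_op B \<and> B \<circ>\<^sub>O B = id_op - T" using posB BB by simp
    fix Q assume Q: "positive_op Q \<and> Q \<circ>\<^sub>O Q = id_op - T"
    have "T = id_op - Q \<circ>\<^sub>O Q" using Q by simp
    then have "Q \<circ>\<^sub>O T = T \<circ>\<^sub>O Q"
      by (simp add: comp_op.diff_left comp_op.diff_right comp_op_assoc)
    then have "Q \<circ>\<^sub>O K = K \<circ>\<^sub>O Q" using K by (auto simp: S_def)
    then have QB: "Q \<circ>\<^sub>O B = B \<circ>\<^sub>O Q" by (simp add: B_def comp_op.diff_left comp_op.diff_right)
    \<comment> \<open>For commuting roots the product is Q^2 - B^2; injectivity of B + Q then forces
      Q = B.\<close>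
    have z: "(B + Q) \<circ>\<^sub>O (Q - B) = 0"
      using Q by (simp add: comp_op.diff_right comp_op.add_left QB BB)
    show "Q = B"
    proof (rule bop_eqI)
      fix x
      define y where "y = app (Q - B) x"
      have "app (B + Q) y = app ((B + Q) \<circ>\<^sub>O (Q - B)) x" by (simp only: y_def comp_op.rep_eq)
      then have "app (B + Q) y = 0" unfolding z by (simp only: zero_bop.rep_eq)
      then have "cinner (app B y) y + cinner (app Q y) y = 0"
        by (metis plus_bop.rep_eq cinner.add_left cinner.zero_left)
      moreover have "0 \<le> Re (cinner (app Q y) y)"
        using Q by (simp add: positive_op_def complex_nonneg_Reals_iff)
      ultimately have "Re (cinner (app B y) y) \<le> 0"
        by (metis add_le_same_cancel1 plus_complex.sel(1) zero_complex.sel(1) add.commute)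
      then have "(1 - s) * (norm y)\<^sup>2 \<le> 0" using lower[of y] by linarith
      then have "y = 0" using s by (simp add: mult_le_0_iff)
      then show "app Q x = app B x" by (simp add: y_def minus_bop.rep_eq)
    qed
  qed
  then show "adj R = R" "R \<circ>\<^sub>O R = id_op - T" using adjB BB by auto
qed

section \<open>Hilbert tensor products\<close>

lemma tensor_vec_linear_simps:
  shows tensor_vec_add_left: "tensor_vec (\<xi> + \<eta>) h = tensor_vec \<xi> h + tensor_vec \<eta> h"
    and tensor_vec_add_right: "tensor_vec \<xi> (h + k) = tensor_vec \<xi> h + tensor_vec \<xi> k"
    and tensor_vec_scaleC_left: "tensor_vec (c *\<^sub>C \<xi>) h = c *\<^sub>C tensor_vec \<xi> h"
    and tensor_vec_scaleC_right: "tensor_vec \<xi> (c *\<^sub>C h) = c *\<^sub>C tensor_vec \<xi> h"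
  by (rule coord_inject[THEN iffD1], simp add: fun_eq_iff tensor_vec.rep_eq plus_ell2.rep_eq
      scaleC_ell2.rep_eq scaleC_add_left scaleC_add_right scaleC_scaleC scaleC_complex_def mult.commute)+

lemma coord_simps:
  shows coord_add: "coord (v + w) i = coord v i + coord w i"
    and coord_zero: "coord 0 i = 0"
    and coord_scaleC: "coord (c *\<^sub>C v) i = c *\<^sub>C coord v i"
    and coord_sum: "coord (sum g I) i = (\<Sum>j\<in>I. coord (g j) i)"
proof -
  show add: "coord (v + w) i = coord v i + coord w i" for v w by (simp add: plus_ell2.rep_eq)
  show z: "coord 0 i = 0" by (simp add: zero_ell2.rep_eq)
  show "coord (sum g I) i = (\<Sum>j\<in>I. coord (g j) i)"
    by (induction I rule: infinite_finite_induct) (simp_all add: add z)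
qed (simp_all add: minus_ell2.rep_eq scaleC_ell2.rep_eq scaleR_ell2.rep_eq)

lemma ell2_eqI: "(\<And>i. coord v i = coord w i) \<Longrightarrow> v = w"
  by (rule coord_inject[THEN iffD1]) auto

lemma coord_tensor_vec: "coord (tensor_vec \<xi> h) i = coord \<xi> i *\<^sub>C h"
  by (simp add: tensor_vec.rep_eq)

lemma coord_ket: "coord (ket i) j = (if j = i then 1 else 0)"
  by (simp add: ket.rep_eq)

lemma cinner_tensor_vec: "cinner (tensor_vec \<xi> h) (tensor_vec \<eta> k) = cinner \<xi> \<eta> * cinner h k"
proof -
  have "cinner (tensor_vec \<xi> h) (tensor_vec \<eta> k)
      = (\<Sum>\<^sub>\<infinity>i. cinner (coord \<xi> i) (coord \<eta> i) * cinner h k)"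
    unfolding cinner_ell2_def
    by (rule infsum_cong)
      (simp add: coord_tensor_vec cinner_scaleC_left cinner_scaleC_right cinner_complex_def)
  then show ?thesis by (simp add: cinner_ell2_def infsum_cmult_left')
qed

lemma cinner_tensor_ket_left: "cinner (tensor_vec (ket i) h) w = cinner h (coord w i)"
proof -
  have "((\<lambda>j. cinner (coord (tensor_vec (ket i) h) j) (coord w j)) has_sum cinner h (coord w i)) UNIV"
  proof (rule has_sum_finite_neutralI[of "{i}"])
    show "cinner h (coord w i) = (\<Sum>j\<in>{i}. cinner (coord (tensor_vec (ket i) h) j) (coord w j))"
      by (simp add: coord_tensor_vec coord_ket)
  qed (auto simp: coord_tensor_vec coord_ket)
  then show ?thesis unfolding cinner_ell2_def by (rule infsumI)
qed

lemma cinner_ket_left: "cinner (ket i) w = cnj (coord w i)"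
proof -
  have "ket i = tensor_vec (ket i) (1::complex)"
    by (rule ell2_eqI) (simp add: coord_tensor_vec scaleC_complex_def)
  then show ?thesis using cinner_tensor_ket_left[of i "1::complex" w] by (simp add: cinner_complex_def)
qed

lemma cinner_ket_right: "cinner w (ket i) = coord w i"
  by (subst cinner_commute) (simp add: cinner_ket_left)

lemma cinner_ket_ket: "cinner (ket i) (ket j) = (if i = j then 1 else 0)"
  by (simp add: cinner_ket_left coord_ket)

lemma norm_tensor_vec: "norm (tensor_vec \<xi> h) = norm \<xi> * norm h"
proof -
  have "complex_of_real ((norm (tensor_vec \<xi> h))\<^sup>2) = of_real ((norm \<xi> * norm h)\<^sup>2)"
    unfolding cinner_self[symmetric] cinner_tensor_vec
    by (simp add: cinner_self power_mult_distrib)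
  then have "(norm (tensor_vec \<xi> h))\<^sup>2 = (norm \<xi> * norm h)\<^sup>2" using of_real_eq_iff by blast
  then show ?thesis by simp
qed

lemma bounded_linear_tensor_vec_left: "bounded_linear (\<lambda>\<xi>. tensor_vec \<xi> h)"
  by (rule bounded_linear_intro[where K = "norm h"])
    (simp_all add: tensor_vec_add_left norm_tensor_vec scaleC_of_real[symmetric] tensor_vec_scaleC_left)

lemma tensor_vec_scaleR_left: "tensor_vec (r *\<^sub>R \<xi>) h = r *\<^sub>R tensor_vec \<xi> h"
  by (simp add: scaleC_of_real[symmetric] tensor_vec_scaleC_left)

section \<open>Basis expansions and a summability criterion\<close>

text \<open>By Pythagoras the squared distance from v to the partial sum over F is the tail of the
  sum of squares outside F.\<close>

lemma has_sum_tensor_ket: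
  fixes v :: "('i, 'a::complex_hilbert) ell2"
  shows "((\<lambda>i. tensor_vec (ket i) (coord v i)) has_sum v) UNIV"
proof -
  have "((\<lambda>i. (norm (coord v i))\<^sup>2) has_sum (norm v)\<^sup>2) UNIV"
    unfolding norm_ell2_square by (intro has_sum_infsum coord_square_summable)
  then have lim: "((\<lambda>F. sqrt ((norm v)\<^sup>2 - (\<Sum>i\<in>F. (norm (coord v i))\<^sup>2))) \<longlongrightarrow> sqrt ((norm v)\<^sup>2 - (norm v)\<^sup>2))
      (finite_subsets_at_top UNIV)"
    unfolding has_sum_def by (intro tendsto_intros)
  have n: "norm ((\<Sum>i\<in>F. tensor_vec (ket i) (coord v i)) - v)
      = sqrt ((norm v)\<^sup>2 - (\<Sum>i\<in>F. (norm (coord v i))\<^sup>2))" if F: "finite F" for F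
  proof -
    define p where "p = (\<Sum>i\<in>F. tensor_vec (ket i) (coord v i))"
    have c: "coord p i = (if i \<in> F then coord v i else 0)" for i
    proof -
      have "coord p i = (\<Sum>j\<in>F. if i = j then coord v i else 0)"
        unfolding p_def coord_sum
        by (intro sum.cong) (auto simp: coord_tensor_vec coord_ket)
      then show ?thesis using F by simp
    qed
    have pw: "cinner p w = (\<Sum>i\<in>F. cinner (coord v i) (coord w i))" for w
      by (simp add: p_def cinner.sum_left cinner_tensor_ket_left)
    have pv: "cinner p v = of_real (\<Sum>i\<in>F. (norm (coord v i))\<^sup>2)"
      unfolding pw by (simp add: cinner_self)
    have "cinner p p = of_real (\<Sum>i\<in>F. (norm (coord v i))\<^sup>2)"
      unfolding pw by (simp add: cinner_self c)
    then have pp: "(norm p)\<^sup>2 = (\<Sum>i\<in>F. (norm (coord v i))\<^sup>2)"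
      unfolding cinner_self by (simp only: of_real_eq_iff)
    have "(norm (p - v))\<^sup>2 = (norm v)\<^sup>2 - (\<Sum>i\<in>F. (norm (coord v i))\<^sup>2)"
      using norm_square_add[of p "- v"] by (simp add: cinner.minus_right pv pp)
    then have "sqrt ((norm (p - v))\<^sup>2) = sqrt ((norm v)\<^sup>2 - (\<Sum>i\<in>F. (norm (coord v i))\<^sup>2))"
      by (rule arg_cong)
    then show ?thesis by (simp add: p_def)
  qed
  show ?thesis
    unfolding has_sum_def
  proof (rule Lim_null[THEN iffD2], rule tendsto_norm_zero_cancel)
    show "((\<lambda>F. norm ((\<Sum>i\<in>F. tensor_vec (ket i) (coord v i)) - v)) \<longlongrightarrow> 0) (finite_subsets_at_top UNIV)"
      by (rule Lim_transform_eventually[OF lim[simplified]])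
        (auto intro!: eventually_finite_subsets_at_top_weakI simp: n)
  qed
qed

lemma has_sum_ket: "((\<lambda>i. coord \<xi> i *\<^sub>C ket i) has_sum \<xi>) UNIV"
proof -
  have "tensor_vec (ket i) (coord \<xi> i) = coord \<xi> i *\<^sub>C ket i" for i
    by (rule ell2_eqI) (simp add: coord_tensor_vec coord_scaleC scaleC_complex_def)
  then show ?thesis using has_sum_tensor_ket[of \<xi>] by simp
qed

text \<open>The uniqueness behind \<open>amplify\<close>: by \<open>has_sum_tensor_ket\<close> the
  vectors \<open>tensor_vec (ket i) h\<close> span a dense subspace.\<close>

lemma bop_eqI_tensor:
  fixes S T :: "(('i, 'a::complex_hilbert) ell2, 'b::complex_hilbert) bop"
  assumes "\<And>i h. app S (tensor_vec (ket i) h) = app T (tensor_vec (ket i) h)"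
  shows "S = T"
proof (rule bop_eqI)
  fix v
  show "app S v = app T v"
    using has_sum_bounded_linear[OF bounded_linear_app has_sum_tensor_ket[of v], of S]
      has_sum_bounded_linear[OF bounded_linear_app has_sum_tensor_ket[of v], of T] assms
    by (simp add: o_def has_sum_unique)
qed

text \<open>Serves families such as orthogonal ones, which may be summable without being absolutely
  summable. The bound is applied to the differences F - H, which gives the Cauchy criterion.\<close>

lemma summable_on_if_square_bound:
  fixes f :: "'i \<Rightarrow> 'a::banach"
  assumes q: "q summable_on UNIV"
    and le: "\<And>F. finite F \<Longrightarrow> (norm (sum f F))\<^sup>2 \<le> sum q F"
  shows "f summable_on UNIV"
proof -
  obtain L where L: "(sum q \<longlongrightarrow> L) (finite_subsets_at_top UNIV)"
    using q by (auto simp: summable_on_def has_sum_def)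
  have "\<exists>P. eventually P (finite_subsets_at_top UNIV) \<and> (\<forall>F G. P F \<and> P G \<longrightarrow> dist (sum f F) (sum f G) < e)"
    if e: "e > 0" for e
  proof -
    \<comment> \<open>The sums of q over F and over H each deviate from L by less than d, so they
      differ by less than 2 d = (e / 2)^2; the square root leaves e / 2 for each of two
      sets.\<close>
    define d where "d = (e / 2)\<^sup>2 / 2"
    have "d > 0" using e by (simp add: d_def)
    then have "eventually (\<lambda>F. dist (sum q F) L < d) (finite_subsets_at_top UNIV)"
      using L by (rule tendstoD[rotated])
    then obtain H where H: "finite H" "\<And>F. finite F \<Longrightarrow> H \<subseteq> F \<Longrightarrow> dist (sum q F) L < d"
      by (auto simp: eventually_finite_subsets_at_top)
    have near: "dist (sum f F) (sum f H) < e / 2" if F: "finite F" "H \<subseteq> F" for F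
    proof -
      have "(norm (sum f F - sum f H))\<^sup>2 = (norm (sum f (F - H)))\<^sup>2"
        using F by (simp add: sum_diff)
      also have "\<dots> \<le> sum q (F - H)" using F by (intro le) simp
      also have "\<dots> = sum q F - sum q H" using F by (simp add: sum_diff)
      also have "\<dots> < 2 * d" using H(2)[OF F] H(2)[OF H(1)] by (simp add: dist_real_def)
      also have "\<dots> = (e / 2)\<^sup>2" by (simp add: d_def)
      finally show ?thesis unfolding dist_norm by (rule power2_less_imp_less) (use e in simp)
    qed
    show ?thesis
    proof (intro exI conjI allI impI)
      show "eventually (\<lambda>F. finite F \<and> H \<subseteq> F) (finite_subsets_at_top UNIV)"
        using H(1) by (auto simp: eventually_finite_subsets_at_top)
      fix F G assume "(finite F \<and> H \<subseteq> F) \<and> finite G \<and> H \<subseteq> G"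
      then show "dist (sum f F) (sum f G) < e"
        using near[of F] near[of G] dist_triangle2[of "sum f F" "sum f G" "sum f H"] by simp
    qed
  qed
  then have "cauchy_filter (filtermap (sum f) (finite_subsets_at_top UNIV))"
    by (simp add: cauchy_filter_metric_filtermap)
  moreover have "complete (UNIV::'a set)" by (rule complete_UNIV)
  ultimately obtain s where "filtermap (sum f) (finite_subsets_at_top UNIV) \<le> nhds s"
    using cauchy_filter_complete_converges[of "filtermap (sum f) (finite_subsets_at_top UNIV)" UNIV]
    by (auto simp: filtermap_bot_iff)
  then have "(sum f \<longlongrightarrow> s) (finite_subsets_at_top UNIV)" by (simp add: filterlim_def)
  then show ?thesis by (auto simp: summable_on_def has_sum_def)
qed

section \<open>Amplifications\<close>

text \<open>With \<open>C = (I - A\<^sup>* A)\<^sup>1\<^sup>/\<^sup>2\<close> the defect \<open>\<Sum> \<parallel>v\<^sub>j\<parallel>\<^sup>2 - \<parallel>\<Sum> A e\<^sub>j \<otimes> v\<^sub>j\<parallel>\<^sup>2\<close> equals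
  \<open>\<parallel>\<Sum> C e\<^sub>j \<otimes> v\<^sub>j\<parallel>\<^sup>2\<close>.\<close>

lemma norm_sum_tensor_strict:
  fixes A :: "(('i, complex) ell2, ('i, complex) ell2) bop" and v :: "'i \<Rightarrow> 'a::complex_hilbert"
  assumes A: "norm A < 1" and F: "finite F"
  shows "(norm (\<Sum>j\<in>F. tensor_vec (app A (ket j)) (v j)))\<^sup>2 \<le> (\<Sum>j\<in>F. (norm (v j))\<^sup>2)"
proof -
  define T where "T = adj A \<circ>\<^sub>O A"
  have "norm T \<le> norm A * norm A" unfolding T_def using norm_comp_op_le[of "adj A" A] by simp
  also have "\<dots> < 1"
    using A mult_strict_mono'[of "norm A" 1 "norm A" 1] by simp
  finally have T1: "norm T < 1" .
  have adjT: "adj T = T" by (simp add: T_def adj_comp)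
  define C where "C = sqrt_op (id_op - T)"
  have C: "adj C = C" "C \<circ>\<^sub>O C = id_op - T"
    unfolding C_def using sqrt_op_id_minus[OF adjT T1] by auto
  define g where "g B = (\<Sum>j\<in>F. tensor_vec (app B (ket j)) (v j))" for B :: "(('i, complex) ell2, ('i, complex) ell2) bop"
  have gg: "cinner (g B) (g B) = (\<Sum>j\<in>F. \<Sum>l\<in>F. cinner (app (adj B \<circ>\<^sub>O B) (ket j)) (ket l) * cinner (v j) (v l))" for B
    unfolding g_def cinner.sum_left
    by (simp add: cinner.sum_right cinner_tensor_vec comp_op.rep_eq cinner_adj')
  \<comment> \<open>By \<open>gg\<close>, B enters only through
    \<open>adj B \<circ>\<^sub>O B\<close>; for A and C these operators add up to the
    identity.\<close>
  have "cinner (g A) (g A) + cinner (g C) (g C) = cinner (g id_op) (g id_op)"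
    unfolding gg sum.distrib[symmetric] C T_def[symmetric]
    by (intro sum.cong refl) (simp add: app_op_simps cinner.diff_left algebra_simps)
  also have "\<dots> = of_real (\<Sum>j\<in>F. (norm (v j))\<^sup>2)"
  proof -
    have "cinner (g id_op) (g id_op) = (\<Sum>j\<in>F. \<Sum>l\<in>F. if j = l then cinner (v j) (v j) else 0)"
      unfolding gg by (intro sum.cong refl) (auto simp: app_op_simps cinner_ket_ket)
    then show ?thesis using F by (simp add: cinner_self)
  qed
  finally have "complex_of_real ((norm (g A))\<^sup>2 + (norm (g C))\<^sup>2) = of_real (\<Sum>j\<in>F. (norm (v j))\<^sup>2)"
    unfolding cinner_self by simp
  then have "(norm (g A))\<^sup>2 + (norm (g C))\<^sup>2 = (\<Sum>j\<in>F. (norm (v j))\<^sup>2)"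
    by (simp only: of_real_eq_iff)
  then show ?thesis unfolding g_def[symmetric] by (metis le_add_same_cancel1 zero_le_power2)
qed

text \<open>Scaling A by the inverse of a number slightly above its norm reduces to the strict case;
  the slack e also covers A = 0.\<close>

lemma norm_sum_tensor_le:
  fixes A :: "(('i, complex) ell2, ('i, complex) ell2) bop" and v :: "'i \<Rightarrow> 'a::complex_hilbert"
  assumes F: "finite F"
  shows "norm (\<Sum>j\<in>F. tensor_vec (app A (ket j)) (v j)) \<le> norm A * L2_set (\<lambda>j. norm (v j)) F"
proof (rule field_le_epsilon)
  fix e :: real assume e: "0 < e"
  define l where "l = L2_set (\<lambda>j. norm (v j)) F"
  have l: "0 \<le> l" by (simp add: l_def)
  \<comment> \<open>The denominator l + 1 is nonzero even for l = 0 and keeps the excess l e / (l +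
    1) below e.\<close>
  define c where "c = norm A + e / (l + 1)"
  have "0 < e / (l + 1)" using e l by simp
  then have c: "norm A < c" "0 < c" unfolding c_def using norm_ge_zero[of A] by linarith+
  define B where "B = (1 / c) *\<^sub>R A"
  have "norm B < 1" using c by (simp add: B_def)
  note * = norm_sum_tensor_strict[OF this F, of v]
  have "(\<Sum>j\<in>F. tensor_vec (app A (ket j)) (v j)) = c *\<^sub>R (\<Sum>j\<in>F. tensor_vec (app B (ket j)) (v j))"
    using c by (simp add: scaleR_sum_right B_def app_op_simps tensor_vec_scaleR_left)
  moreover have "norm (\<Sum>j\<in>F. tensor_vec (app B (ket j)) (v j)) \<le> l"
    unfolding l_def L2_set_def by (rule real_le_rsqrt[OF *])
  ultimately have "norm (\<Sum>j\<in>F. tensor_vec (app A (ket j)) (v j)) \<le> c * l"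
    using c by simp
  also have "\<dots> \<le> norm A * l + e"
    using e l by (simp add: c_def field_simps)
  finally show "norm (\<Sum>j\<in>F. tensor_vec (app A (ket j)) (v j)) \<le> norm A * l + e" .
qed

text \<open>The image of v is forced to be the sum of the A e_j \<otimes> v_j;
  \<open>norm_sum_tensor_le\<close> gives its summability and the norm bound at once.\<close>

lemma amplify_exists:
  fixes A :: "(('i, complex) ell2, ('i, complex) ell2) bop"
  shows "\<exists>T :: (('i, 'a::complex_hilbert) ell2, ('i, 'a) ell2) bop.
    (\<forall>\<xi> h. app T (tensor_vec \<xi> h) = tensor_vec (app A \<xi>) h) \<and> norm T \<le> norm A"
proof -
  define f where "f v = (\<lambda>j. tensor_vec (app A (ket j)) (coord v j))" for v :: "('i, 'a) ell2"
  have smble: "f v summable_on UNIV" for v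
  proof (rule summable_on_if_square_bound)
    show "(\<lambda>j. (norm A)\<^sup>2 * (norm (coord v j))\<^sup>2) summable_on UNIV"
      by (intro summable_on_cmult_right coord_square_summable)
    fix F :: "'i set" assume F: "finite F"
    have "(norm (sum (f v) F))\<^sup>2 \<le> (norm A * L2_set (\<lambda>j. norm (coord v j)) F)\<^sup>2"
      unfolding f_def by (intro power_mono norm_sum_tensor_le F norm_ge_zero)
    also have "\<dots> = (\<Sum>j\<in>F. (norm A)\<^sup>2 * (norm (coord v j))\<^sup>2)"
      by (simp add: power_mult_distrib L2_set_def sum_nonneg sum_distrib_left)
    finally show "(norm (sum (f v) F))\<^sup>2 \<le> (\<Sum>j\<in>F. (norm A)\<^sup>2 * (norm (coord v j))\<^sup>2)" .
  qed
  define T where "T v = infsum (f v) UNIV" for v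
  have hs: "(f v has_sum T v) UNIV" for v unfolding T_def by (intro has_sum_infsum smble)
  have bound: "norm (T v) \<le> norm A * norm v" for v
  proof (rule tendsto_upperbound)
    show "((\<lambda>F. norm (sum (f v) F)) \<longlongrightarrow> norm (T v)) (finite_subsets_at_top UNIV)"
      using hs[of v] unfolding has_sum_def by (rule tendsto_norm)
    show "\<forall>\<^sub>F F in finite_subsets_at_top UNIV. norm (sum (f v) F) \<le> norm A * norm v"
    proof (rule eventually_finite_subsets_at_top_weakI)
      fix F :: "'i set" assume F: "finite F"
      have "norm (sum (f v) F) \<le> norm A * L2_set (\<lambda>j. norm (coord v j)) F"
        unfolding f_def by (rule norm_sum_tensor_le[OF F])
      also have "\<dots> \<le> norm A * norm v" by (intro mult_left_mono L2_set_coord_le F) simp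
      finally show "norm (sum (f v) F) \<le> norm A * norm v" .
    qed
  qed simp
  have app: "app (Abs_bop T) = T"
  proof (rule app_Abs_bop[OF _ _ bound])
    show "T (v + w) = T v + T w" for v w
      by (rule has_sum_unique[OF hs]) (use has_sum_add[OF hs hs, of v w] in
        \<open>simp add: f_def coord_add tensor_vec_add_right\<close>)
    show "T (c *\<^sub>C v) = c *\<^sub>C T v" for c v
      by (rule has_sum_unique[OF hs]) (use has_sum_bounded_linear[OF bounded_linear_scaleC hs, of c v] in
        \<open>simp add: f_def coord_scaleC tensor_vec_scaleC_right o_def\<close>)
  qed
  show ?thesis
  proof (intro exI conjI allI)
    fix \<xi> and h :: 'a
    have "((\<lambda>j. tensor_vec (app A (coord \<xi> j *\<^sub>C ket j)) h) has_sum tensor_vec (app A \<xi>) h) UNIV"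
      using has_sum_bounded_linear[OF bounded_linear_compose[OF bounded_linear_tensor_vec_left bounded_linear_app]
        has_sum_ket[of \<xi>], of A h] by (simp add: o_def)
    moreover have "tensor_vec (app A (coord \<xi> j *\<^sub>C ket j)) h = f (tensor_vec \<xi> h) j" for j
      by (simp add: f_def coord_tensor_vec app_scaleC_right tensor_vec_scaleC_left tensor_vec_scaleC_right)
    ultimately show "app (Abs_bop T) (tensor_vec \<xi> h) = tensor_vec (app A \<xi>) h"
      unfolding app using hs[of "tensor_vec \<xi> h"] by (simp add: has_sum_unique)
    show "norm (Abs_bop T) \<le> norm A" by (rule norm_bop_leI) (simp_all add: app bound)
  qed
qed

lemma amplify_eqI:
  assumes "\<And>i h. app T (tensor_vec (ket i) h) = tensor_vec (app A (ket i)) h"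
  shows "amplify A = T"
proof -
  obtain R :: "(('a, 'b) ell2, ('a, 'b) ell2) bop"
    where R: "\<forall>\<xi> h. app R (tensor_vec \<xi> h) = tensor_vec (app A \<xi>) h"
    using amplify_exists by blast
  have "T = R" by (rule bop_eqI_tensor) (simp add: assms R)
  show ?thesis
    unfolding amplify_def
  proof (rule the_equality)
    show "\<forall>\<xi> h. app T (tensor_vec \<xi> h) = tensor_vec (app A \<xi>) h" using R \<open>T = R\<close> by simp
    fix S :: "(('a, 'b) ell2, ('a, 'b) ell2) bop"
    assume "\<forall>\<xi> h. app S (tensor_vec \<xi> h) = tensor_vec (app A \<xi>) h"
    then show "S = T" by (intro bop_eqI_tensor) (simp add: assms)
  qed
qed

lemma app_amplify: "app (amplify A) (tensor_vec \<xi> h) = tensor_vec (app A \<xi>) h"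
proof -
  obtain T :: "(('a, 'b) ell2, ('a, 'b) ell2) bop"
    where T: "\<forall>\<xi> h. app T (tensor_vec \<xi> h) = tensor_vec (app A \<xi>) h"
    using amplify_exists by blast
  have "amplify A = T" by (rule amplify_eqI) (simp add: T)
  then show ?thesis using T by simp
qed

lemma norm_amplify_le:
  "norm (amplify A :: (('i, 'a::complex_hilbert) ell2, ('i, 'a) ell2) bop) \<le> norm A"
proof -
  obtain T :: "(('i, 'a) ell2, ('i, 'a) ell2) bop"
    where T: "\<forall>\<xi> h. app T (tensor_vec \<xi> h) = tensor_vec (app A \<xi>) h" "norm T \<le> norm A"
    using amplify_exists by blast
  have "amplify A = T" by (rule amplify_eqI) (simp add: T)
  then show ?thesis using T by simp
qed

lemma amplify_add: "amplify (A + B) = amplify A + amplify B"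
  by (rule amplify_eqI) (simp add: app_op_simps app_amplify tensor_vec_add_left)

lemma amplify_scaleC: "amplify (c *\<^sub>C A) = c *\<^sub>C amplify A"
  by (rule amplify_eqI) (simp add: app_op_simps app_amplify tensor_vec_scaleC_left)

lemma amplify_comp: "amplify (A \<circ>\<^sub>O B) = amplify A \<circ>\<^sub>O amplify B"
  by (rule amplify_eqI) (simp add: app_op_simps app_amplify)

lemma amplify_id: "amplify id_op = id_op"
  by (rule amplify_eqI) (simp add: app_op_simps)

lemma amplify_adj: "amplify (adj A) = adj (amplify A)"
proof (rule amplify_eqI)
  fix i h
  show "app (adj (amplify A)) (tensor_vec (ket i) h) = tensor_vec (app (adj A) (ket i)) h"
  proof (rule ell2_eqI, rule cinner_eqI)
    fix j z
    have "cinner (tensor_vec (ket j) z) (app (adj (amplify A)) (tensor_vec (ket i) h))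
        = cinner (tensor_vec (ket j) z) (tensor_vec (app (adj A) (ket i)) h)"
      by (simp add: cinner_adj[symmetric] app_amplify cinner_tensor_vec)
    then show "cinner (coord (app (adj (amplify A)) (tensor_vec (ket i) h)) j) z
        = cinner (coord (tensor_vec (app (adj A) (ket i)) h) j) z"
      unfolding cinner_tensor_ket_left by (metis cinner_commute)
  qed
qed

section \<open>Words and row contractions\<close>

lemma finite_words: "finite {\<alpha> :: 'n::finite list. length \<alpha> = k}"
  using finite_lists_length_eq[of "UNIV :: 'n set" k] by simp

lemma finite_words_less: "finite {\<alpha> :: 'n::finite list. length \<alpha> < k}"
proof -
  have "{\<alpha> :: 'n list. length \<alpha> < k} = (\<Union>j<k. {\<alpha>. length \<alpha> = j})" by auto
  then show ?thesis by (simp add: finite_words)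
qed

text \<open>The last letter is split off because the adjoint of a product reverses the factors: the
  adjoint of X_i then acts last, on a vector to which \<open>sum_norm_adj_le\<close>
  applies.\<close>

lemma sum_words_Suc:
  fixes g :: "'n::finite list \<Rightarrow> 'a::comm_monoid_add"
  shows "(\<Sum>\<alpha> | length \<alpha> = Suc k. g \<alpha>) = (\<Sum>\<alpha> | length \<alpha> = k. \<Sum>i\<in>UNIV. g (\<alpha> @ [i]))"
proof -
  have ne: "\<alpha> \<noteq> []" if "length \<alpha> = Suc k" for \<alpha> :: "'n list" using that by auto
  have "(\<Sum>\<alpha> | length \<alpha> = k. \<Sum>i\<in>UNIV. g (\<alpha> @ [i]))
      = (\<Sum>(\<alpha>, i)\<in>{\<alpha>. length \<alpha> = k} \<times> UNIV. g (\<alpha> @ [i]))"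
    by (rule sum.cartesian_product)
  also have "\<dots> = (\<Sum>\<alpha> | length \<alpha> = Suc k. g \<alpha>)"
    by (rule sum.reindex_bij_witness[where i = "\<lambda>\<alpha>. (butlast \<alpha>, last \<alpha>)" and j = "\<lambda>(\<alpha>, i). \<alpha> @ [i]"])
      (auto simp: ne)
  finally show ?thesis by simp
qed

text \<open>Its norm is the square of the norm of X as a row operator, whence the square roots of
  \<open>norm (row_op X)\<close> below.\<close>

definition row_op :: "('h::complex_hilbert, 'h) bop ^ 'n::finite \<Rightarrow> ('h, 'h) bop" where
  "row_op X = (\<Sum>i\<in>UNIV. X $ i \<circ>\<^sub>O adj (X $ i))"

lemma row_ball_iff: "X \<in> row_ball \<longleftrightarrow> norm (row_op X) < 1"
  by (simp add: row_ball_def row_op_def)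

lemma row_cball_iff: "X \<in> row_cball \<longleftrightarrow> norm (row_op X) \<le> 1"
  by (simp add: row_cball_def row_op_def)

lemma adj_row_op: "adj (row_op X) = row_op X"
  by (simp add: row_op_def adj_sum adj_comp)

lemma cinner_row_op: "cinner (app (row_op X) y) y = of_real (\<Sum>i\<in>UNIV. (norm (app (adj (X $ i)) y))\<^sup>2)"
  by (simp add: row_op_def app_op_simps cinner.sum_left cinner_adj cinner_self)

lemma sum_norm_adj_le:
  "(\<Sum>i\<in>UNIV. (norm (app (adj (X $ i)) y))\<^sup>2) \<le> norm (row_op X) * (norm y)\<^sup>2"
proof -
  have "(\<Sum>i\<in>UNIV. (norm (app (adj (X $ i)) y))\<^sup>2) = Re (cinner (app (row_op X) y) y)"
    by (simp add: cinner_row_op)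
  also have "\<dots> \<le> norm (app (row_op X) y) * norm y"
    using cinner_Cauchy_Schwarz complex_Re_le_cmod order_trans by blast
  also have "\<dots> \<le> norm (row_op X) * norm y * norm y"
    by (intro mult_right_mono norm_app_le) simp
  finally show ?thesis by (simp add: power2_eq_square mult.assoc)
qed

lemma word_op_append: "word_op X (\<alpha> @ \<beta>) = word_op X \<alpha> \<circ>\<^sub>O word_op X \<beta>"
  by (induction \<alpha>) (simp_all add: comp_op_assoc)

lemma app_adj_word_op_snoc:
  "app (adj (word_op X (\<alpha> @ [i]))) h = app (adj (X $ i)) (app (adj (word_op X \<alpha>)) h)"
  by (simp add: word_op_append adj_comp comp_op.rep_eq)

text \<open>The defects telescope in this quantity: by \<open>norm_defect_op\<close>, level k of K_X
  h has squared norm \<open>word_mass X h k - word_mass X h (Suc k)\<close>.\<close>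

definition word_mass :: "('h::complex_hilbert, 'h) bop ^ 'n::finite \<Rightarrow> 'h \<Rightarrow> nat \<Rightarrow> real" where
  "word_mass X h k = (\<Sum>\<alpha> | length \<alpha> = k. (norm (app (adj (word_op X \<alpha>)) h))\<^sup>2)"

lemma word_mass_0: "word_mass X h 0 = (norm h)\<^sup>2"
  by (simp add: word_mass_def app_op_simps)

lemma word_mass_Suc:
  "word_mass X h (Suc k)
    = (\<Sum>\<alpha> | length \<alpha> = k. \<Sum>i\<in>UNIV. (norm (app (adj (X $ i)) (app (adj (word_op X \<alpha>)) h)))\<^sup>2)"
  by (simp add: word_mass_def sum_words_Suc app_adj_word_op_snoc)

lemma word_mass_le: "word_mass X h k \<le> norm (row_op X) ^ k * (norm h)\<^sup>2"
proof (induction k)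
  case 0
  then show ?case by (simp add: word_mass_0)
next
  case (Suc k)
  have "word_mass X h (Suc k)
      \<le> (\<Sum>\<alpha> | length \<alpha> = k. norm (row_op X) * (norm (app (adj (word_op X \<alpha>)) h))\<^sup>2)"
    unfolding word_mass_Suc by (intro sum_mono sum_norm_adj_le)
  also have "\<dots> = norm (row_op X) * word_mass X h k"
    by (simp add: word_mass_def sum_distrib_left)
  also have "\<dots> \<le> norm (row_op X) * (norm (row_op X) ^ k * (norm h)\<^sup>2)"
    by (intro mult_left_mono Suc) simp
  finally show ?case by (simp add: mult.assoc)
qed

text \<open>Against a test vector y the words move over as adjoints, and Cauchy-Schwarz over the
  level leaves the l2 norm of the coefficients times the square root of \<open>word_mass\<close>.
  Estimating term by term would give the l1 norm and lose a factor of up to n^(k/2).\<close>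

lemma norm_word_combination_le:
  "norm (\<Sum>\<alpha> | length \<alpha> = k. a \<alpha> *\<^sub>C word_op X \<alpha>)
    \<le> L2_set (\<lambda>\<alpha>. cmod (a \<alpha>)) {\<alpha>. length \<alpha> = k} * sqrt (norm (row_op X)) ^ k"
proof (rule norm_bop_leI)
  fix h
  define W where "W = {\<alpha> :: 'b list. length \<alpha> = k}"
  define A where "A = L2_set (\<lambda>\<alpha>. cmod (a \<alpha>)) W"
  have A: "0 \<le> A" by (simp add: A_def)
  show "norm (app (\<Sum>\<alpha>\<in>W. a \<alpha> *\<^sub>C word_op X \<alpha>) h) \<le> A * sqrt (norm (row_op X)) ^ k * norm h"
  proof (rule norm_le_cinnerI)
    fix y
    have "cmod (cinner (app (\<Sum>\<alpha>\<in>W. a \<alpha> *\<^sub>C word_op X \<alpha>) h) y)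
        = cmod (\<Sum>\<alpha>\<in>W. a \<alpha> * cinner h (app (adj (word_op X \<alpha>)) y))"
      by (simp add: app_op_simps cinner.sum_left cinner_scaleC_left cinner_adj)
    also have "\<dots> \<le> (\<Sum>\<alpha>\<in>W. cmod (a \<alpha>) * (norm h * norm (app (adj (word_op X \<alpha>)) y)))"
      by (intro sum_norm_le) (simp add: norm_mult mult_left_mono cinner_Cauchy_Schwarz)
    also have "\<dots> = norm h * (\<Sum>\<alpha>\<in>W. \<bar>cmod (a \<alpha>)\<bar> * \<bar>norm (app (adj (word_op X \<alpha>)) y)\<bar>)"
      by (simp add: sum_distrib_left mult_ac)
    also have "\<dots> \<le> norm h * (A * L2_set (\<lambda>\<alpha>. norm (app (adj (word_op X \<alpha>)) y)) W)"
      unfolding A_def by (intro mult_left_mono L2_set_mult_ineq) simp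
    also have "\<dots> \<le> norm h * (A * sqrt (norm (row_op X) ^ k * (norm y)\<^sup>2))"
      unfolding L2_set_def W_def word_mass_def[symmetric]
      by (intro mult_left_mono real_sqrt_le_mono word_mass_le A) simp
    also have "\<dots> = norm h * (A * (sqrt (norm (row_op X)) ^ k * norm y))"
      by (simp add: real_sqrt_mult real_sqrt_power)
    finally show "cmod (cinner (app (\<Sum>\<alpha>\<in>W. a \<alpha> *\<^sub>C word_op X \<alpha>) h) y)
        \<le> A * sqrt (norm (row_op X)) ^ k * norm h * norm y"
      by (simp add: mult_ac)
  qed (use A in simp)
qed simp

section \<open>The Poisson kernel\<close>

lemma norm_defect_op:
  assumes "X \<in> row_ball"
  shows "(norm (app (defect_op X) y))\<^sup>2
    = (norm y)\<^sup>2 - (\<Sum>i\<in>UNIV. (norm (app (adj (X $ i)) y))\<^sup>2)"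
proof -
  have D: "adj (defect_op X) = defect_op X" "defect_op X \<circ>\<^sub>O defect_op X = id_op - row_op X"
    using sqrt_op_id_minus[of "row_op X"] assms
    by (auto simp: adj_row_op row_ball_iff defect_op_def row_op_def[symmetric])
  have "complex_of_real ((norm (app (defect_op X) y))\<^sup>2) = cinner (app (defect_op X \<circ>\<^sub>O defect_op X) y) y"
    unfolding cinner_self[symmetric] by (subst (1) D(1)[symmetric]) (simp add: cinner_adj' comp_op.rep_eq D(1) cinner_adj)
  also have "\<dots> = of_real ((norm y)\<^sup>2 - (\<Sum>i\<in>UNIV. (norm (app (adj (X $ i)) y))\<^sup>2))"
    unfolding D(2) by (simp add: minus_bop.rep_eq id_op.rep_eq cinner.diff_left cinner_row_op cinner_self)
  finally show "(norm (app (defect_op X) y))\<^sup>2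
      = (norm y)\<^sup>2 - (\<Sum>i\<in>UNIV. (norm (app (adj (X $ i)) y))\<^sup>2)"
    by (simp only: of_real_eq_iff)
qed

text \<open>The sums over words shorter than m telescope to
  \<open>(norm h)\<^sup>2 - word_mass X h m\<close>, and the mass decays geometrically in the open
  ball. This is the isometry of the Poisson kernel.\<close>

lemma has_sum_defect_words:
  assumes X: "X \<in> row_ball"
  shows "((\<lambda>\<alpha>. (norm (app (defect_op X) (app (adj (word_op X \<alpha>)) h)))\<^sup>2) has_sum (norm h)\<^sup>2) UNIV"
proof -
  define g where "g \<alpha> = (norm (app (defect_op X) (app (adj (word_op X \<alpha>)) h)))\<^sup>2" for \<alpha>
  have "(\<Sum>\<alpha> | length \<alpha> = k. g \<alpha>) = word_mass X h k - word_mass X h (Suc k)" for k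
    by (simp add: g_def norm_defect_op[OF X] word_mass_Suc sum_subtractf) (simp add: word_mass_def)
  moreover have "(\<Sum>\<alpha> | length \<alpha> < Suc m. g \<alpha>) = (\<Sum>\<alpha> | length \<alpha> < m. g \<alpha>) + (\<Sum>\<alpha> | length \<alpha> = m. g \<alpha>)" for m
  proof -
    have "{\<alpha> :: 'b list. length \<alpha> < Suc m} = {\<alpha>. length \<alpha> < m} \<union> {\<alpha>. length \<alpha> = m}" by auto
    then show ?thesis by (simp only:) (intro sum.union_disjoint finite_words finite_words_less, auto)
  qed
  ultimately have part: "(\<Sum>\<alpha> | length \<alpha> < m. g \<alpha>) = (norm h)\<^sup>2 - word_mass X h m" for m
    by (induction m) (simp_all add: word_mass_0)
  have mass: "0 \<le> word_mass X h m" for m by (simp add: word_mass_def sum_nonneg)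
  have lim: "(\<lambda>m. norm (row_op X) ^ m * (norm h)\<^sup>2) \<longlonglongrightarrow> 0 * (norm h)\<^sup>2"
    using X by (intro tendsto_intros LIMSEQ_power_zero) (simp add: row_ball_iff)
  have "(g has_sum (norm h)\<^sup>2) UNIV"
    unfolding has_sum_def
  proof (rule tendstoI)
    fix e :: real assume "0 < e"
    then have "eventually (\<lambda>m. norm (row_op X) ^ m * (norm h)\<^sup>2 < e) sequentially"
      using lim by (intro order_tendstoD(2)) auto
    then obtain m where "norm (row_op X) ^ m * (norm h)\<^sup>2 < e"
      by (auto simp: eventually_sequentially)
    then have m: "word_mass X h m < e" using word_mass_le[of X h m] by linarith
    \<comment> \<open>F lies between the words shorter than m and those shorter than some M, and
      both of these sums are known by telescoping.\<close>
    have "dist (sum g F) ((norm h)\<^sup>2) < e" if F: "finite F" "{\<alpha>. length \<alpha> < m} \<subseteq> F" for F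
    proof -
      have "(\<Sum>\<alpha> | length \<alpha> < m. g \<alpha>) \<le> sum g F"
        using F by (intro sum_mono2) (auto simp: g_def)
      moreover obtain M where M: "\<And>\<alpha>. \<alpha> \<in> F \<Longrightarrow> length \<alpha> < M"
        using finite_nat_set_iff_bounded[of "length ` F"] F(1) by auto
      have "sum g F \<le> (\<Sum>\<alpha> | length \<alpha> < M. g \<alpha>)"
        using M by (intro sum_mono2 finite_words_less) (auto simp: g_def)
      ultimately show ?thesis using m mass[of M] by (simp add: part dist_real_def)
    qed
    then show "eventually (\<lambda>F. dist (sum g F) ((norm h)\<^sup>2) < e) (finite_subsets_at_top UNIV)"
      unfolding eventually_finite_subsets_at_top
      by (intro exI[of _ "{\<alpha>. length \<alpha> < m}"]) (simp add: finite_words_less)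
  qed
  then show ?thesis unfolding g_def .
qed

text \<open>\<open>poisson_kernel\<close> is built from an infinite sum and \<open>Abs_bop\<close>,
  which say nothing before summability and boundedness are known. So the vector K h with the
  intended coordinates comes first; its basis expansion is the defining sum.\<close>

lemma
  assumes X: "X \<in> row_ball"
  shows coord_poisson_kernel: "coord (app (poisson_kernel X) h) \<alpha>
      = app (defect_op X) (app (adj (word_op X \<alpha>)) h)"
    and norm_app_poisson_kernel: "norm (app (poisson_kernel X) h) = norm h"
proof -
  define c where "c h \<alpha> = app (defect_op X) (app (adj (word_op X \<alpha>)) h)" for h \<alpha>
  define K where "K h = Abs_ell2 (c h)" for h
  have coordK: "coord (K h) = c h" for h
    unfolding K_def using has_sum_imp_summable[OF has_sum_defect_words[OF X, of h]]
    by (intro Abs_ell2_inverse) (simp add: c_def)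
  have normK: "norm (K h) = norm h" for h
    using infsumI[OF has_sum_defect_words[OF X, of h]]
    by (simp add: norm_ell2_def coordK c_def)
  have "poisson_kernel X = Abs_bop K"
    unfolding poisson_kernel_def
  proof (rule arg_cong[where f = Abs_bop], rule ext)
    fix h
    show "(\<Sum>\<^sub>\<infinity>\<alpha>. tensor_vec (ket \<alpha>) (app (defect_op X \<circ>\<^sub>O adj (word_op X \<alpha>)) h)) = K h"
      using infsumI[OF has_sum_tensor_ket[of "K h"]] by (simp add: coordK c_def comp_op.rep_eq)
  qed
  moreover have "app (Abs_bop K) = K"
  proof (rule app_Abs_bop[where B = 1])
    show "K (x + y) = K x + K y" for x y
      by (rule ell2_eqI) (simp add: coord_add coordK c_def app_add_right)
    show "K (a *\<^sub>C x) = a *\<^sub>C K x" for a x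
      by (rule ell2_eqI) (simp add: coord_scaleC coordK c_def app_scaleC_right)
  qed (simp add: normK)
  ultimately have "app (poisson_kernel X) = K" by simp
  then show "coord (app (poisson_kernel X) h) \<alpha> = app (defect_op X) (app (adj (word_op X \<alpha>)) h)"
    "norm (app (poisson_kernel X) h) = norm h"
    by (simp_all add: coordK c_def normK)
qed

lemma norm_poisson_kernel_le: "X \<in> row_ball \<Longrightarrow> norm (poisson_kernel X) \<le> 1"
  by (rule norm_bop_leI) (simp_all add: norm_app_poisson_kernel)

text \<open>The isometry in operator form, by polarisation; it says that P[I] = I.\<close>

lemma adj_poisson_kernel_comp:
  assumes "X \<in> row_ball"
  shows "adj (poisson_kernel X) \<circ>\<^sub>O poisson_kernel X = id_op"
proof -
  have "adj (poisson_kernel X) \<circ>\<^sub>O poisson_kernel X - id_op = 0"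
    by (rule cinner_app_eq_zeroD)
      (simp add: app_op_simps cinner.diff_left cinner_adj' cinner_self norm_app_poisson_kernel[OF assms])
  then show ?thesis by simp
qed

lemma app_creation_ket: "app (creation i) (ket \<beta>) = ket (i # \<beta>)"
proof -
  have "(\<lambda>\<alpha>. case \<alpha> of [] \<Rightarrow> 0 | j # \<gamma> \<Rightarrow> if j = i then coord (ket \<beta>) \<gamma> else 0) = coord (ket (i # \<beta>))"
    by (auto simp: fun_eq_iff coord_ket split: list.splits)
  then show ?thesis by (simp add: creation.rep_eq coord_inverse)
qed

lemma coord_adj_creation: "coord (app (adj (creation i)) \<xi>) \<beta> = coord \<xi> (i # \<beta>)"
  by (simp only: cinner_ket_right[symmetric] cinner_adj' app_creation_ket)

lemma coord_adj_amplify_creation: "coord (app (adj (amplify (creation i))) w) \<beta> = coord w (i # \<beta>)"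
proof (rule cinner_eqI)
  fix z
  have "cinner z (coord (app (adj (amplify (creation i))) w) \<beta>) = cinner z (coord w (i # \<beta>))"
    by (simp only: cinner_tensor_ket_left[symmetric] cinner_adj[symmetric] app_amplify app_creation_ket)
  then show "cinner (coord (app (adj (amplify (creation i))) w) \<beta>) z = cinner (coord w (i # \<beta>)) z"
    by (metis cinner_commute)
qed

text \<open>Both sides have coordinates \<open>\<Delta> X\<^sub>\<beta>\<^sup>* X\<^sub>i\<^sup>* h\<close>; the adjoint form says that \<open>K\<^sup>*\<close>
  intertwines \<open>S\<^sub>i \<otimes> I\<close> with \<open>X\<^sub>i\<close>.\<close>

lemma poisson_kernel_intertwines:
  assumes "X \<in> row_ball"
  shows "adj (amplify (creation i)) \<circ>\<^sub>O poisson_kernel X = poisson_kernel X \<circ>\<^sub>O adj (X $ i)"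
  by (rule bop_eqI, rule ell2_eqI)
    (simp add: comp_op.rep_eq coord_adj_amplify_creation coord_poisson_kernel[OF assms] adj_comp)

section \<open>The Poisson transform\<close>

lemma poisson_add: "poisson (A + B) X = poisson A X + poisson B X"
  by (simp add: poisson_def amplify_add comp_op.add_left comp_op.add_right)

lemma poisson_scaleC: "poisson (c *\<^sub>C A) X = c *\<^sub>C poisson A X"
  by (simp add: poisson_def amplify_scaleC comp_op_scaleC)

lemma poisson_adj: "poisson (adj A) X = adj (poisson A X)"
  by (simp add: poisson_def amplify_adj adj_comp comp_op_assoc)

lemma norm_poisson_le:
  assumes "X \<in> row_ball"
  shows "norm (poisson A X) \<le> norm A"
proof -
  let ?K = "poisson_kernel X"
  have "norm (poisson A X) \<le> norm (adj ?K \<circ>\<^sub>O amplify A) * norm ?K"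
    unfolding poisson_def by (rule norm_comp_op_le)
  also have "\<dots> \<le> norm ?K * norm A * norm ?K"
    by (intro mult_right_mono order_trans[OF norm_comp_op_le]) (simp_all add: mult_left_mono norm_amplify_le)
  also have "\<dots> \<le> 1 * norm A * 1"
    using norm_poisson_kernel_le[OF assms] by (intro mult_mono) auto
  finally show ?thesis by simp
qed

lemma bounded_linear_poisson:
  assumes "X \<in> row_ball"
  shows "bounded_linear (\<lambda>A. poisson A X)"
  by (rule bounded_linear_intro[where K = 1])
    (simp_all add: poisson_add norm_poisson_le[OF assms] scaleC_of_real[symmetric] poisson_scaleC)

text \<open>The adjoint form of the intertwining moves a left factor S_i through the adjoint kernel.
  As A is arbitrary, this can be iterated along a word.\<close>

lemma poisson_creation_comp:
  assumes "X \<in> row_ball"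
  shows "poisson (creation i \<circ>\<^sub>O A) X = X $ i \<circ>\<^sub>O poisson A X"
proof -
  have *: "adj (poisson_kernel X) \<circ>\<^sub>O amplify (creation i) = X $ i \<circ>\<^sub>O adj (poisson_kernel X)"
    using arg_cong[OF poisson_kernel_intertwines[OF assms, of i], of adj] by (simp add: adj_comp)
  have "poisson (creation i \<circ>\<^sub>O A) X
      = (adj (poisson_kernel X) \<circ>\<^sub>O amplify (creation i)) \<circ>\<^sub>O (amplify A \<circ>\<^sub>O poisson_kernel X)"
    by (simp add: poisson_def amplify_comp comp_op_assoc)
  also have "\<dots> = X $ i \<circ>\<^sub>O poisson A X"
    unfolding * by (simp add: poisson_def comp_op_assoc)
  finally show ?thesis .
qed

lemma poisson_word_op:
  assumes "X \<in> row_ball"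
  shows "poisson (word_op creation_tuple \<alpha>) X = word_op X \<alpha>"
proof (induction \<alpha>)
  case Nil
  then show ?case by (simp add: poisson_def amplify_id adj_poisson_kernel_comp[OF assms])
next
  case (Cons i \<alpha>)
  then show ?case by (simp add: creation_tuple_def poisson_creation_comp[OF assms])
qed

section \<open>The noncommutative disc algebra\<close>

text \<open>The polynomials in the S_i, in inductive form for the sake of the resulting induction
  rule.\<close>

inductive_set word_span :: "('n::finite fock, 'n fock) bop set" where
  word: "word_op creation_tuple \<alpha> \<in> word_span"
| add: "A \<in> word_span \<Longrightarrow> B \<in> word_span \<Longrightarrow> A + B \<in> word_span"
| scale: "A \<in> word_span \<Longrightarrow> c *\<^sub>C A \<in> word_span"

lemma word_span_comp:
  assumes "A \<in> word_span" "B \<in> word_span"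
  shows "A \<circ>\<^sub>O B \<in> word_span"
  using assms(1)
proof induction
  case (word \<alpha>)
  show ?case using assms(2)
  proof induction
    case (word \<beta>)
    then show ?case by (metis word_op_append word_span.word)
  qed (auto simp: comp_op.add_right comp_op_scaleC intro: word_span.intros)
qed (auto simp: comp_op.add_left comp_op_scaleC intro: word_span.intros)

text \<open>The hull is the least closed subalgebra containing the generators, and the closure of
  the polynomials is one because sums, products and scalar multiples are continuous.\<close>

lemma disc_algebra_subset_closure: "disc_algebra \<subseteq> closure word_span"
  unfolding disc_algebra_def
proof (rule hull_minimal)
  have "id_op \<in> word_span" using word_span.word[of "[]"] by simp
  moreover have "creation i \<in> word_span" for i
    using word_span.word[of "[i]"] by (simp add: creation_tuple_def)
  ultimately show "insert id_op (range creation) \<subseteq> closure word_span"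
    using closure_subset by blast
  have "A + B \<in> closure word_span" "A \<circ>\<^sub>O B \<in> closure word_span" "c *\<^sub>C A \<in> closure word_span"
    if AB: "A \<in> closure word_span" "B \<in> closure word_span" for A B c
  proof -
    obtain p q where p: "\<And>n. p n \<in> word_span" "p \<longlonglongrightarrow> A" and q: "\<And>n. q n \<in> word_span" "q \<longlonglongrightarrow> B"
      using AB unfolding closure_sequential by blast
    show "A + B \<in> closure word_span"
      unfolding closure_sequential using p q
      by (intro exI[of _ "\<lambda>n. p n + q n"]) (auto intro: word_span.add tendsto_add)
    show "A \<circ>\<^sub>O B \<in> closure word_span"
      unfolding closure_sequential using p q
      by (intro exI[of _ "\<lambda>n. p n \<circ>\<^sub>O q n"]) (auto intro: word_span_comp comp_op.tendsto)
    show "c *\<^sub>C A \<in> closure word_span"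
      unfolding closure_sequential using p
      by (intro exI[of _ "\<lambda>n. c *\<^sub>C p n"])
        (auto intro: word_span.scale bounded_linear.tendsto[OF bounded_linear_scaleC_bop])
  qed
  then show "closed (closure word_span) \<and> subalgebra (closure word_span)"
    by (auto simp: subalgebra_def)
qed

text \<open>Only linear operations and limits have to be checked, since words absorb the products.
  This suits the Poisson transform, which is linear and contractive.\<close>

lemma disc_algebra_induct:
  fixes A :: "('n::finite fock, 'n fock) bop"
  assumes A: "A \<in> disc_algebra"
    and "closed V"
    and "\<And>\<alpha>. word_op creation_tuple \<alpha> \<in> V"
    and "\<And>B C. B \<in> V \<Longrightarrow> C \<in> V \<Longrightarrow> B + C \<in> V"
    and "\<And>B c. B \<in> V \<Longrightarrow> c *\<^sub>C B \<in> V"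
  shows "A \<in> V"
proof -
  have "word_span \<subseteq> V"
  proof
    fix B :: "('n fock, 'n fock) bop" assume "B \<in> word_span"
    then show "B \<in> V" by induction (use assms in auto)
  qed
  then show ?thesis
    using closure_minimal[OF _ \<open>closed V\<close>] disc_algebra_subset_closure A by blast
qed

section \<open>Free holomorphic functions\<close>

lemma app_word_op_creation_ket: "app (word_op creation_tuple \<alpha>) (ket \<beta>) = ket (\<alpha> @ \<beta>)"
  by (induction \<alpha>) (simp_all add: creation_tuple_def app_op_simps app_creation_ket)

text \<open>A root test on levels: the coefficients of level k contribute at most r^k eventually,
  the words at most \<rho>^k.\<close>

lemma free_holomorphic_summable:
  assumes a: "free_holomorphic a" and X: "X \<in> row_ball"
  shows "summable (\<lambda>k. \<Sum>\<alpha> | length \<alpha> = k. a \<alpha> *\<^sub>C word_op X \<alpha>)"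
proof -
  define \<sigma> where "\<sigma> k = (\<Sum>\<alpha> | length \<alpha> = k. (cmod (a \<alpha>))\<^sup>2)" for k
  define \<rho> where "\<rho> = sqrt (norm (row_op X))"
  have \<rho>: "0 \<le> \<rho>" "\<rho> < 1" using X by (simp_all add: \<rho>_def row_ball_iff)
  \<comment> \<open>Any r > 1 with r \<rho> < 1 would serve; this choice also covers \<rho> =
    0.\<close>
  define r where "r = 2 / (1 + \<rho>)"
  have r: "1 < r" "r * \<rho> < 1" using \<rho> by (simp_all add: r_def field_simps)
  have "limsup (\<lambda>k. ereal (\<sigma> k powr (1 / (2 * real k)))) < ereal r"
    using a r unfolding free_holomorphic_def \<sigma>_def
    by (auto intro: order_le_less_trans)
  then have "eventually (\<lambda>k. ereal (\<sigma> k powr (1 / (2 * real k))) < ereal r) sequentially"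
    by (rule Limsup_lessD)
  \<comment> \<open>At k = 0 the exponent is 1 / 0 = 0, and the power could not be undone.\<close>
  then have ev: "eventually (\<lambda>k. \<sigma> k powr (1 / (2 * real k)) < r \<and> k > 0) sequentially"
    using eventually_gt_at_top[of 0] by eventually_elim simp
  have "eventually (\<lambda>k. norm (\<Sum>\<alpha> | length \<alpha> = k. a \<alpha> *\<^sub>C word_op X \<alpha>) \<le> (r * \<rho>) ^ k) sequentially"
    using ev
  proof eventually_elim
    case (elim k)
    have \<sigma>0: "0 \<le> \<sigma> k" by (simp add: \<sigma>_def sum_nonneg)
    have "\<sigma> k = (\<sigma> k powr (1 / (2 * real k))) powr (2 * real k)"
      using elim \<sigma>0 by (simp add: powr_powr)
    also have "\<dots> \<le> r powr (2 * real k)"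
      using elim by (intro powr_mono2) auto
    also have "\<dots> = (r ^ k)\<^sup>2"
      using r powr_realpow[of r "k * 2"] by (simp add: power_mult mult.commute)
    finally have "sqrt (\<sigma> k) \<le> r ^ k" using r by (intro real_le_lsqrt) auto
    then have L: "L2_set (\<lambda>\<alpha>. cmod (a \<alpha>)) {\<alpha>. length \<alpha> = k} \<le> r ^ k"
      by (simp add: L2_set_def \<sigma>_def)
    have "norm (\<Sum>\<alpha> | length \<alpha> = k. a \<alpha> *\<^sub>C word_op X \<alpha>)
        \<le> L2_set (\<lambda>\<alpha>. cmod (a \<alpha>)) {\<alpha>. length \<alpha> = k} * \<rho> ^ k"
      unfolding \<rho>_def by (rule norm_word_combination_le)
    also have "\<dots> \<le> r ^ k * \<rho> ^ k" using L \<rho> by (intro mult_right_mono) auto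
    finally show ?case by (simp add: power_mult_distrib)
  qed
  moreover have "summable (\<lambda>k. (r * \<rho>) ^ k)"
    using r \<rho> by (intro summable_geometric) simp
  ultimately show ?thesis by (rule summable_comparison_test_ev)
qed

lemma free_eval_add:
  assumes "free_holomorphic a" "free_holomorphic b" "X \<in> row_ball"
  shows "free_eval (\<lambda>\<alpha>. a \<alpha> + b \<alpha>) X = free_eval a X + free_eval b X"
  unfolding free_eval_def
  using suminf_add[OF free_holomorphic_summable[OF assms(1,3)] free_holomorphic_summable[OF assms(2,3)]]
  by (simp add: scaleC_add_left sum.distrib)

lemma free_eval_scaleC:
  fixes X :: "('h::complex_hilbert, 'h) bop ^ 'n::finite"
  assumes "free_holomorphic a" "X \<in> row_ball"
  shows "free_eval (\<lambda>\<alpha>. c * a \<alpha>) X = c *\<^sub>C free_eval a X"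
proof -
  interpret bounded_linear "\<lambda>T :: ('h, 'h) bop. c *\<^sub>C T" by (rule bounded_linear_scaleC_bop)
  show ?thesis
    unfolding free_eval_def suminf[OF free_holomorphic_summable[OF assms]]
    by (simp add: sum scaleC_scaleC)
qed

text \<open>The level sums of a Fock space vector are bounded, and the roots of a bounded sequence
  have limsup at most 1.\<close>

lemma free_holomorphic_coord: "free_holomorphic (coord \<xi>)"
proof -
  \<comment> \<open>The summand 1 keeps M positive, so that \<open>M powr 0 = 1\<close> also for
    \<xi> = 0.\<close>
  define M where "M = (norm \<xi>)\<^sup>2 + 1"
  have M: "0 < M" by (simp add: M_def add_nonneg_pos)
  have "(\<Sum>\<alpha> | length \<alpha> = k. (cmod (coord \<xi> \<alpha>))\<^sup>2) \<le> M" for k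
  proof -
    have "(\<Sum>\<alpha> | length \<alpha> = k. (cmod (coord \<xi> \<alpha>))\<^sup>2) \<le> (norm \<xi>)\<^sup>2"
      unfolding norm_ell2_square
      by (rule finite_sum_le_infsum[OF coord_square_summable finite_words]) auto
    then show ?thesis by (simp add: M_def)
  qed
  then have le: "(\<Sum>\<alpha> | length \<alpha> = k. (cmod (coord \<xi> \<alpha>))\<^sup>2) powr (1 / (2 * real k)) \<le> M powr (1 / (2 * real k))" for k
    by (intro powr_mono2) (auto intro: sum_nonneg)
  have "(\<lambda>k. 1 / (2 * real k)) \<longlonglongrightarrow> 0"
    using tendsto_mult_right_zero[OF lim_1_over_n, of "1/2"] by simp
  then have "(\<lambda>k. M powr (1 / (2 * real k))) \<longlonglongrightarrow> M powr 0"
    using M by (intro tendsto_powr tendsto_const) auto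
  then have "(\<lambda>k. ereal (M powr (1 / (2 * real k)))) \<longlonglongrightarrow> 1"
    using M by (simp add: one_ereal_def)
  then have "limsup (\<lambda>k. ereal (M powr (1 / (2 * real k)))) = 1"
    by (intro lim_imp_Limsup) auto
  moreover have "limsup (\<lambda>k. ereal ((\<Sum>\<alpha> | length \<alpha> = k. (cmod (coord \<xi> \<alpha>))\<^sup>2) powr (1 / (2 * real k))))
      \<le> limsup (\<lambda>k. ereal (M powr (1 / (2 * real k))))"
    by (intro Limsup_mono always_eventually) (simp add: le)
  ultimately show ?thesis by (simp add: free_holomorphic_def)
qed

text \<open>Provides the continuity in g of the right-hand side of
  \<open>poisson_eq_free_eval\<close>; the constant is the sum of the geometric series in
  \<rho>.\<close>

lemma bounded_linear_free_eval_coord: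
  assumes X: "X \<in> row_ball"
  shows "bounded_linear (\<lambda>\<xi>. free_eval (coord \<xi>) X)"
proof -
  define \<rho> where "\<rho> = sqrt (norm (row_op X))"
  have \<rho>: "0 \<le> \<rho>" "\<rho> < 1" using X by (simp_all add: \<rho>_def row_ball_iff)
  show ?thesis
  proof (rule bounded_linear_intro)
    show "free_eval (coord (\<xi> + \<eta>)) X = free_eval (coord \<xi>) X + free_eval (coord \<eta>) X" for \<xi> \<eta>
      by (simp only: plus_ell2.rep_eq free_eval_add[OF free_holomorphic_coord free_holomorphic_coord X, symmetric])
    show "free_eval (coord (r *\<^sub>R \<xi>)) X = r *\<^sub>R free_eval (coord \<xi>) X" for r \<xi>
      using free_eval_scaleC[OF free_holomorphic_coord X, of "of_real r" \<xi>]
      by (simp only: scaleC_of_real[symmetric] scaleC_ell2.rep_eq scaleC_complex_def)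
    fix \<xi> :: "'b fock"
    have le: "norm (\<Sum>\<alpha> | length \<alpha> = k. coord \<xi> \<alpha> *\<^sub>C word_op X \<alpha>) \<le> norm \<xi> * \<rho> ^ k" for k
    proof -
      have "norm (\<Sum>\<alpha> | length \<alpha> = k. coord \<xi> \<alpha> *\<^sub>C word_op X \<alpha>)
          \<le> L2_set (\<lambda>\<alpha>. cmod (coord \<xi> \<alpha>)) {\<alpha>. length \<alpha> = k} * \<rho> ^ k"
        unfolding \<rho>_def by (rule norm_word_combination_le)
      also have "\<dots> \<le> norm \<xi> * \<rho> ^ k"
        using \<rho> by (intro mult_right_mono L2_set_coord_le finite_words) simp
      finally show ?thesis .
    qed
    have s: "summable (\<lambda>k. norm \<xi> * \<rho> ^ k)"
      using \<rho> by (intro summable_mult summable_geometric) simp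
    have "norm (free_eval (coord \<xi>) X) \<le> (\<Sum>k. norm \<xi> * \<rho> ^ k)"
      unfolding free_eval_def by (rule norm_suminf_le[OF le s])
    also have "\<dots> = norm \<xi> * (1 / (1 - \<rho>))"
      using \<rho> by (simp add: suminf_mult suminf_geometric summable_geometric)
    finally show "norm (free_eval (coord \<xi>) X) \<le> norm \<xi> * (1 / (1 - \<rho>))" .
  qed
qed

lemma free_eval_coord_scaleC:
  assumes "X \<in> row_ball"
  shows "free_eval (coord (c *\<^sub>C \<xi>)) X = c *\<^sub>C free_eval (coord \<xi>) X"
  using free_eval_scaleC[OF free_holomorphic_coord assms, of c \<xi>]
  by (simp only: scaleC_ell2.rep_eq scaleC_complex_def)

lemma free_eval_single: "free_eval (\<lambda>\<alpha>. if \<alpha> = \<beta> then c else 0) X = c *\<^sub>C word_op X \<beta>"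
proof -
  have "(\<Sum>\<alpha> | length \<alpha> = k. (if \<alpha> = \<beta> then c else 0) *\<^sub>C word_op X \<alpha>)
      = (if k = length \<beta> then c *\<^sub>C word_op X \<beta> else 0)" for k
  proof -
    have "(\<Sum>\<alpha> | length \<alpha> = k. (if \<alpha> = \<beta> then c else 0) *\<^sub>C word_op X \<alpha>)
        = (\<Sum>\<alpha> | length \<alpha> = k. if \<alpha> = \<beta> then c *\<^sub>C word_op X \<beta> else 0)"
      by (intro sum.cong) auto
    then show ?thesis by (auto simp: finite_words)
  qed
  then show ?thesis
    unfolding free_eval_def
    using sums_unique[OF sums_single[of "length \<beta>" "\<lambda>_. c *\<^sub>C word_op X \<beta>"]] by simp
qed

text \<open>The coefficients of \<open>P[g]\<close> are the coordinates of \<open>g 1\<close>: this is clear for words, and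
  both sides are continuous in \<open>g\<close>.\<close>

lemma poisson_eq_free_eval:
  assumes g: "g \<in> disc_algebra" and X: "X \<in> row_ball"
  shows "poisson g X = free_eval (coord (app g (ket []))) X"
proof -
  have "g \<in> {g. poisson g X = free_eval (coord (app g (ket []))) X}"
    using g
  proof (rule disc_algebra_induct)
    show "closed {g. poisson g X = free_eval (coord (app g (ket []))) X}"
      by (intro closed_Collect_eq continuous_intros bounded_linear.continuous_on[OF bounded_linear_poisson[OF X]]
          bounded_linear.continuous_on[OF bounded_linear_compose[OF bounded_linear_free_eval_coord[OF X]
            bounded_linear_app_left]])
    show "word_op creation_tuple \<alpha> \<in> {g. poisson g X = free_eval (coord (app g (ket []))) X}" for \<alpha>
    proof -
      have "coord (ket \<alpha>) = (\<lambda>\<beta>. if \<beta> = \<alpha> then 1 else 0)" by (simp add: fun_eq_iff coord_ket)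
      then show ?thesis
        by (simp add: poisson_word_op[OF X] app_word_op_creation_ket free_eval_single)
    qed
  qed (auto simp: poisson_add poisson_scaleC app_op_simps free_eval_coord_scaleC[OF X]
      linear_simps(1)[OF bounded_linear_free_eval_coord[OF X]])
  then show ?thesis by simp
qed

section \<open>Continuous extension to the closed ball\<close>

lemma scaleR_mem_row_ball:
  assumes "X \<in> row_cball" "0 \<le> r" "r < 1"
  shows "r *\<^sub>R X \<in> row_ball"
proof -
  have "row_op (r *\<^sub>R X) = r\<^sup>2 *\<^sub>R row_op X"
    by (simp add: row_op_def adj_scaleR comp_op.scaleR_left comp_op.scaleR_right scaleR_sum_right power2_eq_square)
  then have "norm (row_op (r *\<^sub>R X)) = r\<^sup>2 * norm (row_op X)" by simp
  also have "\<dots> \<le> r\<^sup>2 * 1" using assms by (intro mult_left_mono) (simp_all add: row_cball_iff)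
  also have "\<dots> < 1" using assms by (simp add: power2_eq_square) (metis mult_strict_mono' mult_1)
  finally show ?thesis by (simp add: row_ball_iff)
qed

lemma row_ball_subset_row_cball: "row_ball \<subseteq> row_cball"
  by (auto simp: row_ball_def row_cball_def)

text \<open>Radial approach to the boundary: a continuous function on the closed ball is determined
  by its values on the open ball.\<close>

lemma continuous_on_row_cball_limit:
  assumes v: "continuous_on row_cball v" and X: "X \<in> row_cball"
  obtains Y where "\<And>k :: nat. Y k \<in> row_ball" "(\<lambda>k. v (Y k)) \<longlonglongrightarrow> v X"
proof
  define Y where "Y k = (1 - 1 / real (Suc k)) *\<^sub>R X" for k
  show Y: "Y k \<in> row_ball" for k
    unfolding Y_def by (rule scaleR_mem_row_ball[OF X]) (simp_all add: field_simps)
  have "Y \<longlonglongrightarrow> (1 - 0) *\<^sub>R X"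
    unfolding Y_def by (intro tendsto_intros LIMSEQ_Suc[OF lim_1_over_n])
  then show "(\<lambda>k. v (Y k)) \<longlonglongrightarrow> v X"
    using X Y row_ball_subset_row_cball
    by (intro continuous_on_tendsto_compose[OF v] always_eventually) (auto simp del: of_nat_Suc)
qed

text \<open>Von Neumann's inequality passes to the boundary along radial limits, whichever extension
  v is given.\<close>

lemma continuous_extension_norm_le:
  assumes v: "is_continuous_extension (poisson A) v" and X: "X \<in> row_cball"
  shows "norm (v X) \<le> norm A"
proof -
  have c: "continuous_on row_cball v" and eq: "\<And>Y. Y \<in> row_ball \<Longrightarrow> v Y = poisson A Y"
    using v by (auto simp: is_continuous_extension_def)
  obtain Y where Y: "\<And>k :: nat. Y k \<in> row_ball" "(\<lambda>k. v (Y k)) \<longlonglongrightarrow> v X"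
    using continuous_on_row_cball_limit[OF c X] by blast
  show ?thesis
  proof (rule LIMSEQ_le_const2)
    show "(\<lambda>k. norm (v (Y k))) \<longlonglongrightarrow> norm (v X)" by (intro tendsto_norm Y)
    show "\<exists>N. \<forall>k\<ge>N. norm (v (Y k)) \<le> norm A" using Y by (auto simp: eq norm_poisson_le)
  qed
qed

lemma continuous_extension_add:
  assumes "is_continuous_extension (poisson A) v" "is_continuous_extension (poisson B) w"
  shows "is_continuous_extension (poisson (A + B)) (\<lambda>X. v X + w X)"
  using assms by (auto simp: is_continuous_extension_def poisson_add intro: continuous_on_add)

lemma continuous_extension_scaleC:
  assumes "is_continuous_extension (poisson A) v"
  shows "is_continuous_extension (poisson (c *\<^sub>C A)) (\<lambda>X. c *\<^sub>C v X)"
  using assms by (auto simp: is_continuous_extension_def poisson_scaleC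
      intro: bounded_linear.continuous_on[OF bounded_linear_scaleC_bop])

lemma continuous_extension_adj:
  assumes "is_continuous_extension (poisson A) v"
  shows "is_continuous_extension (poisson (adj A)) (\<lambda>X. adj (v X))"
  using assms by (auto simp: is_continuous_extension_def poisson_adj
      intro: bounded_linear.continuous_on[OF bounded_linear_adj])

text \<open>For A = B this is the uniqueness of the extension; for the members of a Cauchy sequence
  it makes their extensions uniformly Cauchy on the closed ball.\<close>

lemma continuous_extension_diff_le:
  assumes "is_continuous_extension (poisson A) v" "is_continuous_extension (poisson B) w" "X \<in> row_cball"
  shows "norm (v X - w X) \<le> norm (A - B)"
proof -
  have neg: "(- 1) *\<^sub>C x = - x" for x :: "'x::complex_vector"
    using scaleC_of_real[of "-1" x] by simp
  have "is_continuous_extension (poisson (A + (- 1) *\<^sub>C B)) (\<lambda>X. v X + (- 1) *\<^sub>C w X)"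
    by (intro continuous_extension_add continuous_extension_scaleC assms)
  from continuous_extension_norm_le[OF this assms(3)] show ?thesis by (simp add: neg)
qed

lemma continuous_extension_word_op:
  fixes \<alpha> :: "'n::finite list"
  shows
  "is_continuous_extension (poisson (word_op creation_tuple \<alpha>)) (\<lambda>X. word_op X \<alpha>)"
proof -
  have "continuous_on S (\<lambda>X :: ('h::complex_hilbert, 'h) bop ^ 'n. word_op X \<alpha>)" for S
    by (induction \<alpha>) (auto intro!: comp_op.continuous_on continuous_intros)
  then show ?thesis by (simp add: is_continuous_extension_def poisson_word_op)
qed

text \<open>The extensions converge uniformly, so their limit is continuous, and on the open ball it
  is P[B] by continuity of P. The pointwise limit is kept in the conclusion in order to evaluate w
  at S.\<close>

lemma continuous_extension_limit:
  assumes A: "A \<longlonglongrightarrow> B" and v: "\<And>m. is_continuous_extension (poisson (A m)) (v m)"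
  obtains w where "is_continuous_extension (poisson B) w"
    "\<And>X. X \<in> row_cball \<Longrightarrow> (\<lambda>m. v m X) \<longlonglongrightarrow> w X"
proof -
  have "\<exists>w. \<forall>e>0. \<exists>N. \<forall>m X. N \<le> m \<and> X \<in> row_cball \<longrightarrow> dist (v m X) (w X) < e"
    unfolding uniformly_convergent_eq_cauchy[of "\<lambda>X. X \<in> row_cball" v]
  proof (intro allI impI)
    fix e :: real assume "0 < e"
    then obtain N where N: "\<forall>m\<ge>N. \<forall>n\<ge>N. norm (A m - A n) < e"
      using CauchyD[OF LIMSEQ_imp_Cauchy[OF A]] by blast
    show "\<exists>N. \<forall>m n X. N \<le> m \<and> N \<le> n \<and> X \<in> row_cball \<longrightarrow> dist (v m X) (v n X) < e"
      using N continuous_extension_diff_le[OF v v] unfolding dist_norm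
      by (meson order_le_less_trans)
  qed
  then obtain w where w: "\<forall>e>0. \<exists>N. \<forall>m X. N \<le> m \<and> X \<in> row_cball \<longrightarrow> dist (v m X) (w X) < e" by blast
  then have ul: "uniform_limit row_cball v w sequentially"
    by (simp add: uniform_limit_sequentially_iff) blast
  show thesis
  proof
    show lim: "(\<lambda>m. v m X) \<longlonglongrightarrow> w X" if "X \<in> row_cball" for X
      using tendsto_uniform_limitI[OF ul that] .
    have "continuous_on row_cball w"
      by (rule uniform_limit_theorem[OF _ ul]) (use v in \<open>auto simp: is_continuous_extension_def\<close>)
    moreover have "w X = poisson B X" if X: "X \<in> row_ball" for X
    proof (rule LIMSEQ_unique)
      show "(\<lambda>m. v m X) \<longlonglongrightarrow> w X" using lim X row_ball_subset_row_cball by blast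
      show "(\<lambda>m. v m X) \<longlonglongrightarrow> poisson B X"
        using bounded_linear.tendsto[OF bounded_linear_poisson[OF X] A] v X
        by (simp add: is_continuous_extension_def)
    qed
    ultimately show "is_continuous_extension (poisson B) w" by (simp add: is_continuous_extension_def)
  qed
qed

text \<open>The operators whose transform extends form a closed linear subspace that contains the
  words.\<close>

lemma disc_algebra_continuous_extension:
  fixes g :: "('n::finite fock, 'n fock) bop"
  assumes "g \<in> disc_algebra"
  obtains v :: "('h::complex_hilbert, 'h) bop ^ 'n \<Rightarrow> ('h, 'h) bop"
  where "is_continuous_extension (poisson g) v"
proof -
  define V where "V = {g. \<exists>v :: ('h, 'h) bop ^ 'n \<Rightarrow> ('h, 'h) bop. is_continuous_extension (poisson g) v}"
  have "g \<in> V"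
    using assms
  proof (rule disc_algebra_induct)
    show "closed V"
      unfolding closed_sequential_limits
    proof (intro allI impI, elim conjE)
      fix A B assume "\<forall>n :: nat. A n \<in> V" and lim: "A \<longlonglongrightarrow> B"
      then have "\<forall>n. \<exists>v :: ('h, 'h) bop ^ 'n \<Rightarrow> ('h, 'h) bop. is_continuous_extension (poisson (A n)) v"
        by (simp add: V_def)
      from choice[OF this] obtain v :: "nat \<Rightarrow> ('h, 'h) bop ^ 'n \<Rightarrow> ('h, 'h) bop"
        where "\<And>n. is_continuous_extension (poisson (A n)) (v n)" by blast
      from continuous_extension_limit[OF lim this] show "B \<in> V" unfolding V_def by blast
    qed
  qed (auto simp: V_def
      intro: continuous_extension_word_op continuous_extension_add continuous_extension_scaleC)
  then show thesis using that by (auto simp: V_def)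
qed

section \<open>Boundary values at the creation operators\<close>

text \<open>The sum of the S_i S_i^* is the projection onto the orthogonal complement of the vacuum
  \<open>ket []\<close>: removing the first letter and restoring it fixes every nonempty
  word.\<close>

lemma creation_tuple_mem_row_cball: "creation_tuple \<in> row_cball"
proof -
  define T :: "('a fock, 'a fock) bop" where "T = row_op creation_tuple"
  have "cinner (app T (ket \<alpha>)) \<xi> = (case \<alpha> of [] \<Rightarrow> 0 | _ \<Rightarrow> cinner (ket \<alpha>) \<xi>)" for \<alpha> \<xi>
  proof -
    have "app (adj (creation i)) (ket \<alpha>) = (case \<alpha> of [] \<Rightarrow> 0 | j # \<beta> \<Rightarrow> if i = j then ket \<beta> else 0)" for i
      by (rule ell2_eqI) (auto simp: coord_adj_creation coord_ket coord_zero split: list.splits)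
    then show ?thesis
      by (auto simp: T_def row_op_def creation_tuple_def app_op_simps app_creation_ket cinner.sum_left
          if_distrib[of "app _"] if_distrib[of "\<lambda>x. cinner x _"] split: list.splits cong: if_cong)
  qed
  moreover have "coord (app T \<xi>) \<alpha> = cnj (cinner (app T (ket \<alpha>)) \<xi>)" for \<xi> \<alpha>
    unfolding cinner_ket_right[symmetric] T_def
    by (subst cinner_adj) (simp add: adj_row_op cinner_commute[of \<xi>])
  ultimately have c: "coord (app T \<xi>) \<alpha> = (case \<alpha> of [] \<Rightarrow> 0 | _ \<Rightarrow> coord \<xi> \<alpha>)" for \<xi> \<alpha>
    by (simp add: cinner_ket_left split: list.splits)
  have "norm T \<le> 1"
  proof (rule norm_bop_leI)
    fix \<xi>
    have "norm (app T \<xi>) \<le> norm \<xi>"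
    proof (rule norm_ell2_leI)
      fix F :: "'a list set" assume F: "finite F"
      have "L2_set (\<lambda>\<alpha>. norm (coord (app T \<xi>) \<alpha>)) F \<le> L2_set (\<lambda>\<alpha>. norm (coord \<xi> \<alpha>)) F"
        by (intro L2_set_mono) (auto simp: c split: list.splits)
      also have "\<dots> \<le> norm \<xi>" by (rule L2_set_coord_le[OF F])
      finally show "L2_set (\<lambda>\<alpha>. norm (coord (app T \<xi>) \<alpha>)) F \<le> norm \<xi>" .
    qed
    then show "norm (app T \<xi>) \<le> 1 * norm \<xi>" by simp
  qed simp
  then show ?thesis by (simp add: row_cball_iff T_def)
qed

text \<open>The induction runs over the existence of some extension with the right value at S, a
  property that passes to limits. Uniqueness of extensions transfers the value to the given
  v.\<close>

lemma disc_algebra_extension_at_creation: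
  assumes "g \<in> disc_algebra" and v: "is_continuous_extension (poisson g) v"
  shows "v creation_tuple = g"
proof -
  have "g \<in> {g. \<exists>v. is_continuous_extension (poisson g) v \<and> v creation_tuple = g}"
    using assms(1)
  proof (rule disc_algebra_induct)
    show "closed {g. \<exists>v. is_continuous_extension (poisson g) v \<and> v creation_tuple = g}"
      unfolding closed_sequential_limits
    proof (intro allI impI, elim conjE)
      fix A :: "nat \<Rightarrow> _" and B
      assume "\<forall>n. A n \<in> {g. \<exists>v. is_continuous_extension (poisson g) v \<and> v creation_tuple = g}"
        and lim: "A \<longlonglongrightarrow> B"
      then have "\<forall>n. \<exists>v. is_continuous_extension (poisson (A n)) v \<and> v creation_tuple = A n" by simp
      from choice[OF this] obtain v where v: "\<And>n. is_continuous_extension (poisson (A n)) (v n)"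
        "\<And>n. v n creation_tuple = A n" by blast
      obtain w where w: "is_continuous_extension (poisson B) w"
        "\<And>X. X \<in> row_cball \<Longrightarrow> (\<lambda>m. v m X) \<longlonglongrightarrow> w X"
        using continuous_extension_limit[OF lim v(1)] by blast
      have "w creation_tuple = B"
        using w(2)[OF creation_tuple_mem_row_cball] lim by (simp add: v(2) LIMSEQ_unique)
      then show "B \<in> {g. \<exists>v. is_continuous_extension (poisson g) v \<and> v creation_tuple = g}"
        using w(1) by blast
    qed
  next
    show "word_op creation_tuple \<alpha>
        \<in> {g. \<exists>v. is_continuous_extension (poisson g) v \<and> v creation_tuple = g}" for \<alpha>
      using continuous_extension_word_op by blast
  qed (use continuous_extension_add continuous_extension_scaleC in fastforce)+
  then obtain w where w: "is_continuous_extension (poisson g) w" "w creation_tuple = g" by blast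
  show ?thesis
    using continuous_extension_diff_le[OF v w(1) creation_tuple_mem_row_cball] w(2) by simp
qed

section \<open>Coefficients of free pluriharmonic functions\<close>

text \<open>Only the term of the empty word survives in the difference of the two series.\<close>

lemma free_eval_sub_const:
  assumes "free_holomorphic a" "free_holomorphic b" "X \<in> row_ball"
    and eq: "\<And>\<alpha>. \<alpha> \<noteq> [] \<Longrightarrow> a \<alpha> = b \<alpha>"
  shows "free_eval a X - free_eval b X = (a [] - b []) *\<^sub>C id_op"
proof -
  have "free_eval a X - free_eval b X
      = (\<Sum>k. (\<Sum>\<alpha> | length \<alpha> = k. a \<alpha> *\<^sub>C word_op X \<alpha>) - (\<Sum>\<alpha> | length \<alpha> = k. b \<alpha> *\<^sub>C word_op X \<alpha>))"
    unfolding free_eval_def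
    by (rule suminf_diff[OF free_holomorphic_summable[OF assms(1,3)] free_holomorphic_summable[OF assms(2,3)]])
  also have "\<dots> = (\<Sum>k. \<Sum>\<alpha> | length \<alpha> = k. (if \<alpha> = [] then a [] - b [] else 0) *\<^sub>C word_op X \<alpha>)"
  proof (intro arg_cong[where f = suminf] ext)
    fix k
    have "a \<alpha> *\<^sub>C word_op X \<alpha> - b \<alpha> *\<^sub>C word_op X \<alpha>
        = (if \<alpha> = [] then a [] - b [] else 0) *\<^sub>C word_op X \<alpha>" for \<alpha>
      using scaleC_add_left[of "a \<alpha> - b \<alpha>" "b \<alpha>" "word_op X \<alpha>"] eq[of \<alpha>] by (auto simp: algebra_simps)
    then show "(\<Sum>\<alpha> | length \<alpha> = k. a \<alpha> *\<^sub>C word_op X \<alpha>) - (\<Sum>\<alpha> | length \<alpha> = k. b \<alpha> *\<^sub>C word_op X \<alpha>)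
        = (\<Sum>\<alpha> | length \<alpha> = k. (if \<alpha> = [] then a [] - b [] else 0) *\<^sub>C word_op X \<alpha>)"
      by (simp add: sum_subtractf[symmetric])
  qed
  also have "\<dots> = (a [] - b []) *\<^sub>C id_op"
    using free_eval_single[of "[]" "a [] - b []" X] by (simp add: free_eval_def)
  finally show ?thesis .
qed

text \<open>Creation operators only lengthen words. So the vacuum column of F(S / 2) lists the
  coefficients, while its vacuum row vanishes off the diagonal; this separates F from its
  adjoint.\<close>

lemma cinner_free_eval_half_creation:
  fixes a :: "'n::finite list \<Rightarrow> complex"
  assumes a: "free_holomorphic a"
  defines "M \<equiv> free_eval a ((1/2) *\<^sub>R creation_tuple)"
  shows "cinner (app M (ket [])) (ket \<alpha>) = (1/2) ^ length \<alpha> * a \<alpha>"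
    and "\<alpha> \<noteq> [] \<Longrightarrow> cinner (app M (ket \<alpha>)) (ket []) = 0"
proof -
  let ?X = "(1/2) *\<^sub>R creation_tuple :: ('n fock, 'n fock) bop ^ 'n"
  have X: "?X \<in> row_ball" by (rule scaleR_mem_row_ball[OF creation_tuple_mem_row_cball]) auto
  have word: "word_op ?X \<gamma> = (1/2) ^ length \<gamma> *\<^sub>R word_op creation_tuple \<gamma>" for \<gamma>
    by (induction \<gamma>) (simp_all add: comp_op.scaleR_left comp_op.scaleR_right)
  define t where "t \<beta> \<alpha> k = (\<Sum>\<gamma> | length \<gamma> = k. (1/2) ^ k * a \<gamma> * (if \<gamma> @ \<beta> = \<alpha> then 1 else 0))" for \<beta> \<alpha> k
  have entry: "cinner (app M (ket \<beta>)) (ket \<alpha>) = suminf (t \<beta> \<alpha>)" for \<alpha> \<beta>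
  proof -
    interpret bounded_linear "\<lambda>T :: ('n fock, 'n fock) bop. cinner (app T (ket \<beta>)) (ket \<alpha>)"
      by (rule bounded_linear_compose[OF cinner.bounded_linear_left bounded_linear_app_left])
    have "cinner (app (\<Sum>\<gamma> | length \<gamma> = k. a \<gamma> *\<^sub>C word_op ?X \<gamma>) (ket \<beta>)) (ket \<alpha>) = t \<beta> \<alpha> k" for k
      unfolding t_def app_sum_left cinner.sum_left
      by (intro sum.cong refl) (simp add: word app_op_simps cinner_scaleC_left cinner.scaleR_left
          app_word_op_creation_ket cinner_ket_ket scaleR_conv_of_real)
    then show ?thesis
      unfolding M_def free_eval_def suminf[OF free_holomorphic_summable[OF a X]] by presburger
  qed
  have "t [] \<alpha> k = (if k = length \<alpha> then (1/2) ^ length \<alpha> * a \<alpha> else 0)" for k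
  proof -
    have "t [] \<alpha> k = (\<Sum>\<gamma> | length \<gamma> = k. if \<gamma> = \<alpha> then (1/2) ^ k * a \<alpha> else 0)"
      unfolding t_def by (intro sum.cong) auto
    then show ?thesis by (auto simp: finite_words)
  qed
  then have "t [] \<alpha> = (\<lambda>k. if k = length \<alpha> then (1/2) ^ length \<alpha> * a \<alpha> else 0)" by (rule ext)
  then show "cinner (app M (ket [])) (ket \<alpha>) = (1/2) ^ length \<alpha> * a \<alpha>"
    unfolding entry
    using sums_unique[OF sums_single[of "length \<alpha>" "\<lambda>_. (1/2) ^ length \<alpha> * a \<alpha>"]] by simp
  show "cinner (app M (ket \<alpha>)) (ket []) = 0" if "\<alpha> \<noteq> []"
  proof -
    have "t \<alpha> [] = (\<lambda>_. 0)" using that by (simp add: fun_eq_iff t_def)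
    then show ?thesis unfolding entry by simp
  qed
qed

lemma app_Re_op: "app (Re_op T) x = (1/2) *\<^sub>C (app T x + app (adj T) x)"
  by (simp add: Re_op_def app_op_simps)

text \<open>The vacuum column yields a + i b and the vacuum row yields cnj a + i cnj b at each
  nonempty word; together they determine a and b. At the empty word both coincide, and only the real
  parts are visible.\<close>

lemma pluriharmonic_coefficients_unique:
  assumes ab: "is_pluriharmonic_with a b (u :: ('n::finite fock, 'n fock) bop ^ 'n \<Rightarrow> _)"
    and cd: "is_pluriharmonic_with c d u"
  shows "\<alpha> \<noteq> [] \<Longrightarrow> a \<alpha> = c \<alpha>" "\<alpha> \<noteq> [] \<Longrightarrow> b \<alpha> = d \<alpha>"
    "Re (a []) = Re (c [])" "Re (b []) = Re (d [])"
proof -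
  let ?X = "(1/2) *\<^sub>R creation_tuple :: ('n fock, 'n fock) bop ^ 'n"
  have X: "?X \<in> row_ball" by (rule scaleR_mem_row_ball[OF creation_tuple_mem_row_cball]) auto
  have hol: "free_holomorphic a" "free_holomorphic b" "free_holomorphic c" "free_holomorphic d"
    using ab cd by (auto simp: is_pluriharmonic_with_def)
  have eq: "Re_op (free_eval a ?X) + \<i> *\<^sub>C Re_op (free_eval b ?X)
      = Re_op (free_eval c ?X) + \<i> *\<^sub>C Re_op (free_eval d ?X)"
    using ab cd X by (simp add: is_pluriharmonic_with_def)
  have adj_entry: "cinner (app (adj M) x) y = cnj (cinner (app M y) x)" for M :: "('n fock, 'n fock) bop" and x y
    by (metis cinner_adj' cinner_commute)
  note entry = plus_bop.rep_eq scaleC_bop.rep_eq app_Re_op cinner.add_left cinner_scaleC_left adj_entry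
    cinner_free_eval_half_creation[OF hol(1)] cinner_free_eval_half_creation[OF hol(2)]
    cinner_free_eval_half_creation[OF hol(3)] cinner_free_eval_half_creation[OF hol(4)]
  have first: "cinner (app (Re_op (free_eval a ?X) + \<i> *\<^sub>C Re_op (free_eval b ?X)) x) y
      = cinner (app (Re_op (free_eval c ?X) + \<i> *\<^sub>C Re_op (free_eval d ?X)) x) y" for x y
    by (simp only: eq)
  {
    assume ne: "\<alpha> \<noteq> []"
    have 1: "(1/2) ^ length \<alpha> * (a \<alpha> + \<i> * b \<alpha>) = (1/2) ^ length \<alpha> * (c \<alpha> + \<i> * d \<alpha>)"
      using first[of "ket []" "ket \<alpha>"] ne by (simp add: entry field_simps)
    have 2: "(1/2) ^ length \<alpha> * (cnj (a \<alpha>) + \<i> * cnj (b \<alpha>)) = (1/2) ^ length \<alpha> * (cnj (c \<alpha>) + \<i> * cnj (d \<alpha>))"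
      using first[of "ket \<alpha>" "ket []"] ne by (simp add: entry field_simps)
    from 1 have 1: "a \<alpha> + \<i> * b \<alpha> = c \<alpha> + \<i> * d \<alpha>" by simp
    from 2 have "cnj (a \<alpha>) + \<i> * cnj (b \<alpha>) = cnj (c \<alpha>) + \<i> * cnj (d \<alpha>)" by simp
    with 1 show "a \<alpha> = c \<alpha>" "b \<alpha> = d \<alpha>" by (auto simp: complex_eq_iff)
  }
  have "(1/2) * (a [] + cnj (a [])) + \<i> * ((1/2) * (b [] + cnj (b [])))
      = (1/2) * (c [] + cnj (c [])) + \<i> * ((1/2) * (d [] + cnj (d [])))"
    using first[of "ket []" "ket []"] by (simp add: entry)
  then show "Re (a []) = Re (c [])" "Re (b []) = Re (d [])" by (auto simp: complex_eq_iff)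
qed

text \<open>The two values differ by an imaginary multiple of the identity, which
  \<open>Re_op\<close> removes. The space is arbitrary here, so coefficients compared over the Fock
  space can be exchanged over any other.\<close>

lemma Re_op_free_eval_cong:
  assumes "free_holomorphic a" "free_holomorphic b" "X \<in> row_ball"
    and "\<And>\<alpha>. \<alpha> \<noteq> [] \<Longrightarrow> a \<alpha> = b \<alpha>" and "Re (a []) = Re (b [])"
  shows "Re_op (free_eval a X) = Re_op (free_eval b X)"
proof -
  define c where "c = a [] - b []"
  have c: "c + cnj c = 0" using assms(5) by (simp add: c_def complex_eq_iff)
  have "free_eval a X = free_eval b X + c *\<^sub>C id_op"
    using free_eval_sub_const[OF assms(1-4)] by (simp add: c_def algebra_simps)
  then have "free_eval a X + adj (free_eval a X) = free_eval b X + adj (free_eval b X) + (c + cnj c) *\<^sub>C id_op"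
    by (simp add: adj_add adj_scaleC scaleC_add_left)
  then show ?thesis by (simp add: Re_op_def c)
qed

section \<open>The pluriharmonic representation of P[f] and the conclusion\<close>

text \<open>The coefficients depend on g and h alone, so one pair serves all Hilbert spaces; being
  coordinates of Fock space vectors, they are free holomorphic.\<close>

lemma adj_disc_algebra_plus_pluriharmonic:
  assumes g: "g \<in> disc_algebra" and h: "h \<in> disc_algebra"
  shows "is_pluriharmonic_with (coord (app g (ket []) + app h (ket [])))
    (coord ((- \<i>) *\<^sub>C (app g (ket []) - app h (ket [])))) (poisson (adj h + g))"
  unfolding is_pluriharmonic_with_def
proof (intro conjI ballI free_holomorphic_coord)
  fix X :: "('b, 'b) bop ^ 'a" assume X: "X \<in> row_ball"
  interpret bounded_linear "\<lambda>\<xi>. free_eval (coord \<xi>) X" by (rule bounded_linear_free_eval_coord[OF X])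
  define G H where "G = poisson g X" and "H = poisson h X"
  have sum: "free_eval (coord (app g (ket []) + app h (ket []))) X = G + H"
    by (simp add: G_def H_def poisson_eq_free_eval g h X add)
  have diff: "free_eval (coord ((- \<i>) *\<^sub>C (app g (ket []) - app h (ket [])))) X = (- \<i>) *\<^sub>C (G - H)"
    by (simp add: G_def H_def poisson_eq_free_eval g h X diff free_eval_coord_scaleC)
  have "adj H + G = Re_op (G + H) + \<i> *\<^sub>C Re_op ((- \<i>) *\<^sub>C (G - H))"
    by (rule bop_eqI, rule cinner_eqI)
      (simp add: app_op_simps app_Re_op adj_add adj_scaleC adj_diff cinner.add_left cinner.diff_left
        cinner_scaleC_left field_simps)
  then show "poisson (adj h + g) X
      = Re_op (free_eval (coord (app g (ket []) + app h (ket []))) X)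
        + \<i> *\<^sub>C Re_op (free_eval (coord ((- \<i>) *\<^sub>C (app g (ket []) - app h (ket [])))) X)"
    unfolding sum diff by (simp add: poisson_add poisson_adj G_def H_def)
qed

theorem theorem6p4:
  fixes f :: "('n::finite fock, 'n fock) bop"
    and u :: "('h::complex_hilbert, 'h) bop ^ 'n \<Rightarrow> ('h, 'h) bop"
    and u_fock :: "('n fock, 'n fock) bop ^ 'n \<Rightarrow> ('n fock, 'n fock) bop"
  assumes "f \<in> adj_disc_algebra_plus"
    and "u = poisson f"
    and "u_fock = poisson f"
  shows
    "((\<exists>a b. is_pluriharmonic_with a b u_fock) \<and>
      (\<forall>a b. is_pluriharmonic_with a b u_fock \<longrightarrow> is_pluriharmonic_with a b u)) \<and>
     (\<exists>v. is_continuous_extension u v) \<and>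
     (\<exists>v. is_continuous_extension u_fock v) \<and>
     (\<forall>v. is_continuous_extension u_fock v \<longrightarrow> v creation_tuple = f)"
proof -
  obtain g h where g: "g \<in> disc_algebra" and h: "h \<in> disc_algebra" and f: "f = adj h + g"
    using assms(1) by (auto simp: adj_disc_algebra_plus_def)
  define a0 b0 where "a0 = coord (app g (ket []) + app h (ket []))"
    and "b0 = coord ((- \<i>) *\<^sub>C (app g (ket []) - app h (ket [])))"
  have plu: "is_pluriharmonic_with a0 b0 u" and plf: "is_pluriharmonic_with a0 b0 u_fock"
    using adj_disc_algebra_plus_pluriharmonic[OF g h] by (simp_all add: assms f a0_def b0_def)
  \<comment> \<open>\<open>a0\<close>, \<open>b0\<close> represent both \<open>u_fock\<close> and
    \<open>u\<close>. Uniqueness, used over the Fock space, ties a, b to them and so carries a, b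
    over to \<open>'h\<close>.\<close>
  have "is_pluriharmonic_with a b u" if ab: "is_pluriharmonic_with a b u_fock" for a b
  proof -
    note uniq = pluriharmonic_coefficients_unique[OF ab plf]
    have hol: "free_holomorphic a" "free_holomorphic b" "free_holomorphic a0" "free_holomorphic b0"
      using ab plf by (auto simp: is_pluriharmonic_with_def)
    have "Re_op (free_eval a X) = Re_op (free_eval a0 X)" "Re_op (free_eval b X) = Re_op (free_eval b0 X)"
      if "X \<in> row_ball" for X :: "('h, 'h) bop ^ 'n"
      using that uniq hol by (auto intro!: Re_op_free_eval_cong)
    then show ?thesis using plu hol by (simp add: is_pluriharmonic_with_def)
  qed
  moreover have "\<exists>v. is_continuous_extension u v"
  proof -
    obtain v w :: "('h, 'h) bop ^ 'n \<Rightarrow> ('h, 'h) bop"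
      where "is_continuous_extension (poisson g) v" "is_continuous_extension (poisson h) w"
      using disc_algebra_continuous_extension g h by metis
    then show ?thesis
      unfolding assms f by (blast intro: continuous_extension_add continuous_extension_adj)
  qed
  moreover obtain v w :: "('n fock, 'n fock) bop ^ 'n \<Rightarrow> ('n fock, 'n fock) bop"
    where v: "is_continuous_extension (poisson g) v" and w: "is_continuous_extension (poisson h) w"
    using disc_algebra_continuous_extension g h by metis
  have vw: "v creation_tuple = g" "w creation_tuple = h"
    using disc_algebra_extension_at_creation g h v w by auto
  have uf: "is_continuous_extension u_fock (\<lambda>X. adj (w X) + v X)"
    unfolding assms f by (intro continuous_extension_add continuous_extension_adj v w)
  \<comment> \<open>Two extensions of the same transform are at distance at most
    \<open>norm (f - f) = 0\<close>, so v' agrees at S with the constructed one.\<close>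
  moreover have "v' creation_tuple = f" if "is_continuous_extension u_fock v'" for v'
    using continuous_extension_diff_le[OF that[unfolded assms(3)] uf[unfolded assms(3)] creation_tuple_mem_row_cball]
    by (simp add: vw f)
  ultimately show ?thesis using plf by blast
qed

end
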